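(* There is an algorithm which takes as input a graph $G$ on $n$ vertices with maximum degree $\Delta$ and enumerates a vertex cover of $G$ whose size is at most twice the minimum size of a vertex cover of $G$. The algorithm runs in time $n^{O(\Delta)}$ and uses $O(\Delta \log n)$ bits of space.
   Context: Model of computation: word RAM with words of $O(\log n)$ bits; the input is read-only; output is written to a write-only stream; space is measured as the number of bits of auxiliary read-write memory used. A vertex cover is a set of vertices meeting every edge. *)

theory Defs
  imports Complex_Main
begin

text \<open>Finite simple graphs on the vertex set \<open>{..<n}\<close>, given by their sets of edges.\<close>

definition simple_graph :: "nat \<Rightarrow> nat set set \<Rightarrow> bool" where
  "simple_graph n E \<longleftrightarrow> (\<forall>e\<in>E. \<exists>u v. u < n \<and> v < n \<and> u \<noteq> v \<and> e = {u, v})"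

definition vertex_degree :: "nat set set \<Rightarrow> nat \<Rightarrow> nat" where
  "vertex_degree E v = card {e \<in> E. v \<in> e}"

text \<open>The inserted 0 only matters for the graph without vertices.\<close>

definition max_degree :: "nat \<Rightarrow> nat set set \<Rightarrow> nat" where
  "max_degree n E = Max (insert 0 (vertex_degree E ` {..<n}))"

definition vertex_cover :: "nat \<Rightarrow> nat set set \<Rightarrow> nat set \<Rightarrow> bool" where
  "vertex_cover n E C \<longleftrightarrow> C \<subseteq> {..<n} \<and> (\<forall>e\<in>E. C \<inter> e \<noteq> {})"

definition min_vertex_cover :: "nat \<Rightarrow> nat set set \<Rightarrow> nat" where
  "min_vertex_cover n E = Min (card ` {C. vertex_cover n E C})"

text \<open>
  Adjacency-list representation of a graph as an array of numbers: cell 0 holds \<open>n\<close>,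
  cells \<open>1, \<dots>, n + 1\<close> hold offsets, and the rest is the concatenation of the adjacency lists.
  The neighbours of \<open>v\<close> are found in the cells \<open>x ! (v + 1), \<dots>, x ! (v + 2) - 1\<close> of the array
  \<open>x\<close>. Each list may be in any order, so a graph has several representations.
\<close>

definition adjacency_lists :: "nat \<Rightarrow> nat set set \<Rightarrow> nat list list \<Rightarrow> bool" where
  "adjacency_lists n E adj \<longleftrightarrow> length adj = n \<and>
     (\<forall>v<n. distinct (adj ! v) \<and> set (adj ! v) = {u. {u, v} \<in> E})"

definition adjacency_array :: "nat list list \<Rightarrow> nat list" where
  "adjacency_array adj =
     (let n = length adj
      in n # map (\<lambda>v. n + 2 + length (concat (take v adj))) [0..<n + 1] @ concat adj)"

definition represents :: "nat list \<Rightarrow> nat \<Rightarrow> nat set set \<Rightarrow> bool" where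
  "represents x n E \<longleftrightarrow> (\<exists>adj. adjacency_lists n E adj \<and> x = adjacency_array adj)"

text \<open>
  Word RAM. A word of length \<open>w\<close> is a number below \<open>2 ^ w\<close>. There are no registers besides the
  program counter: the operands of instructions are addresses of cells of the read-write
  memory, so every piece of working storage is charged for.
\<close>

datatype binop =
  Add | Sub | Mul | Div | Mod | And | Or | Xor | Shl | Shr | Less | Equal

fun binop_val :: "nat \<Rightarrow> binop \<Rightarrow> nat \<Rightarrow> nat \<Rightarrow> nat" where
  "binop_val w Add a b = (a + b) mod 2 ^ w"
| "binop_val w Sub a b = (a + 2 ^ w - b) mod 2 ^ w"
| "binop_val w Mul a b = (a * b) mod 2 ^ w"
| "binop_val w Div a b = a div b"
| "binop_val w Mod a b = a mod b"
| "binop_val w And a b = Bit_Operations.and a b"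
| "binop_val w Or a b = Bit_Operations.or a b"
| "binop_val w Xor a b = Bit_Operations.xor a b"
| "binop_val w Shl a b = push_bit b a mod 2 ^ w"
| "binop_val w Shr a b = drop_bit b a"
| "binop_val w Less a b = of_bool (a < b)"
| "binop_val w Equal a b = of_bool (a = b)"

datatype instr =
  Const nat nat            \<comment> \<open>\<open>Const d k\<close>: \<open>M[d] := k\<close>\<close>
| Bin binop nat nat nat    \<comment> \<open>\<open>Bin f d a b\<close>: \<open>M[d] := f M[a] M[b]\<close>\<close>
| Load nat nat             \<comment> \<open>\<open>Load d a\<close>: \<open>M[d] := M[M[a]]\<close>\<close>
| Store nat nat            \<comment> \<open>\<open>Store a b\<close>: \<open>M[M[a]] := M[b]\<close>\<close>
| Read nat nat             \<comment> \<open>\<open>Read d a\<close>: \<open>M[d] := input[M[a]]\<close>\<close>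
| Write nat                \<comment> \<open>\<open>Write a\<close>: append \<open>M[a]\<close> to the output stream\<close>
| Jump nat                 \<comment> \<open>\<open>Jump l\<close>: go to instruction \<open>l\<close>\<close>
| JumpZero nat nat         \<comment> \<open>\<open>JumpZero a l\<close>: go to instruction \<open>l\<close> if \<open>M[a] = 0\<close>\<close>

type_synonym program = "instr list"

text \<open>
  The component \<open>cells\<close> is the least \<open>k\<close> such that all memory accesses made so far, by
  reading or writing, were to addresses below \<open>k\<close>.
\<close>

record config =
  pc :: nat
  mem :: "nat \<Rightarrow> nat"
  written :: "nat list"
  cells :: nat

definition init_config :: config where
  "init_config = \<lparr>pc = 0, mem = (\<lambda>_. 0), written = [], cells = 0\<rparr>"

fun accessed :: "(nat \<Rightarrow> nat) \<Rightarrow> instr \<Rightarrow> nat set" where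
  "accessed M (Const d k) = {d}"
| "accessed M (Bin f d a b) = {d, a, b}"
| "accessed M (Load d a) = {d, a, M a}"
| "accessed M (Store a b) = {a, b, M a}"
| "accessed M (Read d a) = {d, a}"
| "accessed M (Write a) = {a}"
| "accessed M (Jump l) = {}"
| "accessed M (JumpZero a l) = {a}"

text \<open>Reading beyond the end of the input yields 0.\<close>

definition input_word :: "nat \<Rightarrow> nat list \<Rightarrow> nat \<Rightarrow> nat" where
  "input_word w x i = (if i < length x then x ! i mod 2 ^ w else 0)"

fun new_mem :: "nat \<Rightarrow> nat list \<Rightarrow> instr \<Rightarrow> (nat \<Rightarrow> nat) \<Rightarrow> (nat \<Rightarrow> nat)" where
  "new_mem w x (Const d k) M = M(d := k mod 2 ^ w)"
| "new_mem w x (Bin f d a b) M = M(d := binop_val w f (M a) (M b))"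
| "new_mem w x (Load d a) M = M(d := M (M a))"
| "new_mem w x (Store a b) M = M(M a := M b)"
| "new_mem w x (Read d a) M = M(d := input_word w x (M a))"
| "new_mem w x _ M = M"

fun new_pc :: "instr \<Rightarrow> (nat \<Rightarrow> nat) \<Rightarrow> nat \<Rightarrow> nat" where
  "new_pc (Jump l) M p = l"
| "new_pc (JumpZero a l) M p = (if M a = 0 then l else p + 1)"
| "new_pc _ M p = p + 1"

fun new_output :: "instr \<Rightarrow> (nat \<Rightarrow> nat) \<Rightarrow> nat list \<Rightarrow> nat list" where
  "new_output (Write a) M ys = ys @ [M a]"
| "new_output _ M ys = ys"

definition exec_instr :: "nat \<Rightarrow> nat list \<Rightarrow> instr \<Rightarrow> config \<Rightarrow> config" where
  "exec_instr w x i s =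
     \<lparr>pc = new_pc i (mem s) (pc s),
      mem = new_mem w x i (mem s),
      written = new_output i (mem s) (written s),
      cells = Max (insert (cells s) (Suc ` accessed (mem s) i))\<rparr>"

definition halted :: "program \<Rightarrow> config \<Rightarrow> bool" where
  "halted P s \<longleftrightarrow> length P \<le> pc s"

definition step :: "program \<Rightarrow> nat \<Rightarrow> nat list \<Rightarrow> config \<Rightarrow> config" where
  "step P w x s = (if halted P s then s else exec_instr w x (P ! pc s) s)"

definition config_at :: "program \<Rightarrow> nat \<Rightarrow> nat list \<Rightarrow> nat \<Rightarrow> config" where
  "config_at P w x t = (step P w x ^^ t) init_config"

text \<open>
  \<open>runs P w x ys t b\<close>: on a machine with words of length \<open>w\<close> and input \<open>x\<close>, the program \<open>P\<close>
  halts after exactly \<open>t\<close> steps, having written \<open>ys\<close> and used \<open>b\<close> bits of read-write memory.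
\<close>

definition runs ::
  "program \<Rightarrow> nat \<Rightarrow> nat list \<Rightarrow> nat list \<Rightarrow> nat \<Rightarrow> nat \<Rightarrow> bool" where
  "runs P w x ys t b \<longleftrightarrow>
     halted P (config_at P w x t) \<and> (\<forall>t'<t. \<not> halted P (config_at P w x t')) \<and>
     ys = written (config_at P w x t) \<and> b = w * cells (config_at P w x t)"

text \<open>Words of \<open>O(log n)\<close> bits, with \<open>c\<close> the hidden constant; \<open>max 2\<close> keeps \<open>log n\<close> positive.\<close>

definition word_length :: "nat \<Rightarrow> nat \<Rightarrow> nat" where
  "word_length c n = c * nat \<lceil>log 2 (real (max 2 n))\<rceil>"

end

theory Submission
  imports Defs "HOL-Library.Disjoint_Sets"
begin

text \<open>
  Call \<open>y\<close> the stage-\<open>i\<close> target of \<open>v\<close> if \<open>y\<close> is entry \<open>i\<close> of the adjacency list of \<open>v\<close> and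
  \<open>v < y\<close>. Every edge occurs in exactly one of the stages \<open>0, \<dots>, \<Delta> - 1\<close>, and the edges of one
  stage form a forest in which every vertex has at most one, larger, parent. A maximal matching
  is built greedily, edges being ordered by stage, then by decreasing parent, then by increasing
  child; its endpoints are the cover. Whether a vertex is matched after stage \<open>i\<close> depends on
  the vertices matched before stage \<open>i\<close> and on a walk towards the root, along which the answer is
  negated at every step. The walk needs constantly many words, so the recursion over
  the stages needs \<open>O(\<Delta>)\<close> words, and each level multiplies the time by a polynomial in \<open>n\<close>.
\<close>

section \<open>Greedy matching in stages\<close>

text \<open>
  Within one stage, \<open>f\<close> maps each vertex to its target and \<open>D\<close> holds for the vertices matched in
  earlier stages. Then \<open>saturated n f D p b\<close> says that \<open>p\<close> is already matched when the greedy
  procedure reaches the edge from \<open>b\<close> to its target \<open>p\<close>: the edge from \<open>p\<close> to \<open>f p\<close> comes before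
  all edges from below into \<open>p\<close>, which come in the order of their lower ends. A smaller
  child that is unmatched at the beginning of the stage need not be the partner of \<open>p\<close>, but it
  fails to become so only if \<open>p\<close> is matched anyway.
\<close>

function saturated :: "nat \<Rightarrow> (nat \<Rightarrow> nat) \<Rightarrow> (nat \<Rightarrow> bool) \<Rightarrow> nat \<Rightarrow> nat \<Rightarrow> bool" where
  "saturated n f D p b \<longleftrightarrow> D p \<or> (\<exists>u<b. u < p \<and> f u = p \<and> \<not> D u) \<or>
     (if p < f p \<and> f p < n then \<not> saturated n f D (f p) p else False)"
  by pat_completeness auto
termination
  by (relation "measure (\<lambda>(n, f, D, p, b). n - p)") auto

declare saturated.simps [simp del]

text \<open>The conditional in the defining equation provides the guard needed for termination; a
  plain conjunction suits the later proofs.\<close>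

lemma saturated_unfold:
  "saturated n f D p b \<longleftrightarrow> D p \<or> (\<exists>u<b. u < p \<and> f u = p \<and> \<not> D u) \<or>
     p < f p \<and> f p < n \<and> \<not> saturated n f D (f p) p"
  by (subst saturated.simps) auto

fun matched :: "nat \<Rightarrow> (nat \<Rightarrow> nat \<Rightarrow> nat) \<Rightarrow> nat \<Rightarrow> nat \<Rightarrow> bool" where
  "matched n f 0 v = False"
| "matched n f (Suc i) v = saturated n (f i) (matched n f i) v n"

text \<open>\<open>b\<close> only bounds the existential; the recursive call has second argument
  \<open>p\<close>, whatever \<open>b\<close> is.\<close>

lemma saturated_mono:
  "saturated n f D p b \<Longrightarrow> b \<le> b' \<Longrightarrow> saturated n f D p b'"
  by (subst (asm) saturated_unfold, subst saturated_unfold) (auto intro: less_le_trans)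

text \<open>The chosen edges, named by their lower ends. Of \<open>u\<close> itself only
  \<open>\<not> D u\<close> is asked: its upward edge precedes all edges into it from below, so
  \<open>u\<close> cannot have been matched earlier in the same stage.\<close>

definition stage_edges :: "nat \<Rightarrow> (nat \<Rightarrow> nat) \<Rightarrow> (nat \<Rightarrow> bool) \<Rightarrow> nat set" where
  "stage_edges n f D = {u. u < f u \<and> f u < n \<and> \<not> D u \<and> \<not> saturated n f D (f u) u}"

lemma stage_edges_notD:
  assumes "u \<in> stage_edges n f D"
  shows "\<not> D u" "\<not> D (f u)"
  using assms by (auto simp: stage_edges_def saturated_unfold[of n f D "f u"])

text \<open>A common vertex would be the lower end of one edge and the upper end of the other, or
  the upper end of both. Either way the earlier edge saturates it before the later one is
  reached.\<close>

lemma stage_edges_disjoint: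
  assumes u: "u \<in> stage_edges n f D" and u': "u' \<in> stage_edges n f D" and "u \<noteq> u'"
  shows "{u, f u} \<inter> {u', f u'} = {}"
proof -
  have "v \<noteq> f v'" if "v \<in> stage_edges n f D" "v' \<in> stage_edges n f D" for v v'
    using that by (auto simp: stage_edges_def saturated_unfold[of n f D "f v'" v'])
  moreover have "f v \<noteq> f v'"
    if "v \<in> stage_edges n f D" "v' \<in> stage_edges n f D" "v < v'" for v v'
    using that by (auto simp: stage_edges_def saturated_unfold[of n f D "f v'" v'])
  ultimately show ?thesis
    using assms by (auto simp: neq_iff)
qed

text \<open>With \<open>b = n\<close> no edge into \<open>v\<close> is still to come. For the
  implication to the right: if \<open>v\<close> is not matched before the stage and its upward edge
  is not chosen, then its least child unmatched before the stage finds \<open>v\<close> unsaturated,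
  so the edge from that child is chosen.\<close>

lemma saturated_iff:
  assumes "v < n"
  shows "saturated n f D v n \<longleftrightarrow> D v \<or> (\<exists>u\<in>stage_edges n f D. v \<in> {u, f u})"
    (is "?L \<longleftrightarrow> ?R")
proof
  assume ?R
  then consider "D v" | "v \<in> stage_edges n f D" | u where "u \<in> stage_edges n f D" "v = f u"
    by auto
  then show ?L
  proof cases
    case 3
    then have "u < n \<and> u < v \<and> f u = v \<and> \<not> D u"
      using assms by (auto simp: stage_edges_def)
    then show ?thesis
      by (subst saturated_unfold) blast
  qed (auto simp: stage_edges_def saturated_unfold[of n f D v])
next
  assume L: ?L
  show ?R
  proof (rule ccontr)
    assume neg: "\<not> ?R"
    then have "\<not> D v" and up: "\<not> (v < f v \<and> f v < n \<and> \<not> saturated n f D (f v) v)"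
      by (auto simp: stage_edges_def)
    with L obtain u0 where "u0 < v \<and> f u0 = v \<and> \<not> D u0"
      by (auto simp: saturated_unfold[of n f D v])
    then obtain u where u: "u < v" "f u = v" "\<not> D u"
      and min: "\<And>u'. u' < u \<Longrightarrow> \<not> (u' < v \<and> f u' = v \<and> \<not> D u')"
      using exists_least_iff[of "\<lambda>u. u < v \<and> f u = v \<and> \<not> D u"] by auto
    have "\<not> saturated n f D v u"
      using \<open>\<not> D v\<close> up min by (auto simp: saturated_unfold[of n f D v u])
    then have "u \<in> stage_edges n f D"
      using u assms by (simp add: stage_edges_def)
    with neg u(2) show False by blast
  qed
qed

lemma matched_mono: "i \<le> j \<Longrightarrow> matched n f i v \<Longrightarrow> matched n f j v"
proof (induction j rule: dec_induct)
  case (step j)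
  then show ?case by (subst matched.simps, subst saturated_unfold) simp
qed

text \<open>Maximality of the matching: if the edge is not chosen, its lower end was matched before
  the stage or its upper end was saturated when the edge was reached, and saturation
  persists.\<close>

lemma matched_endpoint:
  assumes "u < f i u" "f i u < n"
  shows "matched n f (Suc i) u \<or> matched n f (Suc i) (f i u)"
proof (cases "matched n f i u \<or> u \<in> stage_edges n (f i) (matched n f i)")
  case True
  then show ?thesis
    using assms by (auto simp: saturated_iff)
next
  case False
  then have "saturated n (f i) (matched n f i) (f i u) u"
    using assms by (auto simp: stage_edges_def)
  then show ?thesis
    using saturated_mono[of n "f i" "matched n f i" "f i u" u n] assms by simp
qed

text \<open>Stage by stage, the chosen edges are added to \<open>F\<close>: they are disjoint from
  each other and avoid the vertices matched before, and \<open>saturated_iff\<close> identifies the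
  vertices covered.\<close>

lemma matched_is_matching:
  assumes "\<And>i u. u < f i u \<Longrightarrow> f i u < n \<Longrightarrow> {u, f i u} \<in> E"
  shows "\<exists>F\<subseteq>E. (\<forall>e\<in>F. card e = 2) \<and> disjoint F \<and> \<Union>F = {v. v < n \<and> matched n f i v}"
proof (induction i)
  case 0
  show ?case by (intro exI[of _ "{}"]) (auto simp: disjoint_def)
next
  case (Suc i)
  then obtain F where F: "F \<subseteq> E" "\<forall>e\<in>F. card e = 2" "disjoint F"
    "\<Union>F = {v. v < n \<and> matched n f i v}"
    by auto
  let ?A = "stage_edges n (f i) (matched n f i)"
  let ?G = "(\<lambda>u. {u, f i u}) ` ?A"
  have A: "u < f i u" "f i u < n" if "u \<in> ?A" for u
    using that by (auto simp: stage_edges_def)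
  have "disjoint ?G"
  proof (rule disjointI)
    fix a b assume "a \<in> ?G" "b \<in> ?G" "a \<noteq> b"
    then obtain u u' where "u \<in> ?A" "u' \<in> ?A" "a = {u, f i u}" "b = {u', f i u'}" "u \<noteq> u'"
      by auto
    then show "a \<inter> b = {}"
      using stage_edges_disjoint[of u n "f i" "matched n f i" u'] by simp
  qed
  moreover have "\<Union>F \<inter> \<Union>?G = {}"
    using F(4) stage_edges_notD[of _ n "f i" "matched n f i"] by auto
  ultimately have "disjoint (F \<union> ?G)"
    using F(3) by (intro disjoint_union) auto
  moreover have "\<Union>(F \<union> ?G) = {v. v < n \<and> matched n f (Suc i) v}"
  proof (rule set_eqI)
    fix v
    have "v < n" if "v \<in> {u, f i u}" "u \<in> ?A" for u
      using A[OF that(2)] that(1) by auto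
    moreover have "v \<in> \<Union>?G \<longleftrightarrow> (\<exists>u\<in>?A. v \<in> {u, f i u})"
      by auto
    ultimately show "v \<in> \<Union>(F \<union> ?G) \<longleftrightarrow> v \<in> {v. v < n \<and> matched n f (Suc i) v}"
      unfolding Union_Un_distrib F(4) Un_iff mem_Collect_eq matched.simps
      using saturated_iff[of v n "f i" "matched n f i"] by blast
  qed
  moreover have "F \<union> ?G \<subseteq> E" "\<forall>e\<in>F \<union> ?G. card e = 2"
    using F(1,2) A assms by (auto simp: card_insert_if) (metis less_irrefl)
  ultimately show ?case by blast
qed

text \<open>Choosing for each edge a vertex of \<open>K\<close> on it is injective, because the
  edges are disjoint.\<close>

lemma matching_le_twice_cover:
  assumes "finite F" "disjoint F" "\<And>e. e \<in> F \<Longrightarrow> card e = 2" "finite K"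
    "\<And>e. e \<in> F \<Longrightarrow> K \<inter> e \<noteq> {}"
  shows "card (\<Union>F) \<le> 2 * card K"
proof -
  obtain g where g: "\<And>e. e \<in> F \<Longrightarrow> g e \<in> K \<inter> e"
    using bchoice[of F "\<lambda>e v. v \<in> K \<inter> e"] assms(5) by blast
  have "inj_on g F"
  proof (rule inj_onI)
    fix e e' assume e: "e \<in> F" "e' \<in> F" "g e = g e'"
    then have "g e \<in> e \<inter> e'"
      using g[of e] g[of e'] by simp
    then show "e = e'"
      using disjointD[OF assms(2) e(1,2)] by blast
  qed
  moreover have "g ` F \<subseteq> K"
    using g by auto
  ultimately have "card F \<le> card K"
    using assms(4) card_inj_on_le by blast
  moreover have "card (\<Union>F) \<le> (\<Sum>e\<in>F. card e)"
    by (rule card_Union_le_sum_card)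
  ultimately show ?thesis
    using assms(3) by simp
qed

section \<open>Loop-free code and its weakest preconditions\<close>

datatype com =
  Skip
| Ins instr
| Seq com com  (infixr ";;" 60)
| IfNZ nat com com

fun clen :: "com \<Rightarrow> nat" where
  "clen Skip = 0"
| "clen (Ins i) = 1"
| "clen (c ;; d) = clen c + clen d"
| "clen (IfNZ r c d) = clen c + clen d + 2"

text \<open>Jump targets are absolute, so \<open>k\<close> carries the address at which the code
  will be placed.\<close>

fun code :: "nat \<Rightarrow> com \<Rightarrow> program" where
  "code k Skip = []"
| "code k (Ins i) = [i]"
| "code k (c ;; d) = code k c @ code (k + clen c) d"
| "code k (IfNZ r c d) =
     JumpZero r (k + clen c + 2) # code (k + 1) c @
     Jump (k + clen c + clen d + 2) # code (k + clen c + 2) d"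

lemma length_code [simp]: "length (code k c) = clen c"
  by (induction c arbitrary: k) auto

text \<open>
  Weakest precondition of loop-free code, including that only cells below \<open>S\<close> are accessed.
  The condition on \<open>new_pc\<close> excludes jumps as basic instructions.
\<close>

fun wp :: "nat \<Rightarrow> nat list \<Rightarrow> nat \<Rightarrow> com \<Rightarrow> ((nat \<Rightarrow> nat) \<Rightarrow> nat list \<Rightarrow> bool) \<Rightarrow>
    (nat \<Rightarrow> nat) \<Rightarrow> nat list \<Rightarrow> bool" where
  "wp w x S Skip Q M ys = Q M ys"
| "wp w x S (Ins i) Q M ys \<longleftrightarrow> (\<forall>p. new_pc i M p = p + 1) \<and> accessed M i \<subseteq> {..<S} \<and>
     Q (new_mem w x i M) (new_output i M ys)"
| "wp w x S (c ;; d) Q M ys = wp w x S c (wp w x S d Q) M ys"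
| "wp w x S (IfNZ r c d) Q M ys \<longleftrightarrow>
     r < S \<and> (if M r \<noteq> 0 then wp w x S c Q M ys else wp w x S d Q M ys)"

lemma wp_mono:
  assumes "wp w x S c Q M ys" and "\<And>M ys. Q M ys \<Longrightarrow> R M ys"
  shows "wp w x S c R M ys"
  using assms
proof (induction c arbitrary: Q R M ys)
  case (Seq c d)
  have "wp w x S d R M ys" if "wp w x S d Q M ys" for M ys
    using that Seq.prems(2) by (rule Seq.IH(2))
  with Seq.IH(1)[of "wp w x S d Q" M ys "wp w x S d R"] Seq.prems(1) show ?case
    by simp
qed (auto split: if_splits)

section \<open>Execution of loop-free code on the machine\<close>

abbreviation config_of :: "nat \<Rightarrow> (nat \<Rightarrow> nat) \<Rightarrow> nat list \<Rightarrow> nat \<Rightarrow> config" where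
  "config_of p M ys k \<equiv> \<lparr>pc = p, mem = M, written = ys, cells = k\<rparr>"

lemma step_at:
  assumes "P = pre @ i # post" "p = length pre"
  shows "step P w x (config_of p M ys k) =
    config_of (new_pc i M p) (new_mem w x i M) (new_output i M ys)
      (Max (insert k (Suc ` accessed M i)))"
  using assms by (simp add: step_def halted_def exec_instr_def)

lemma finite_accessed [simp]: "finite (accessed M i)"
  by (cases i) auto

lemma Max_accessed_le:
  "k \<le> S \<Longrightarrow> accessed M i \<subseteq> {..<S} \<Longrightarrow> Max (insert k (Suc ` accessed M i)) \<le> S"
  by (subst Max_le_iff) (auto simp: Suc_le_eq)

text \<open>All jumps in the generated code lead forward, so no instruction is executed twice and
  the length bounds the time.\<close>

lemma code_correct:
  assumes "wp w x S c Q M ys" "k \<le> S" "P = pre @ code p c @ post" "p = length pre"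
  shows "\<exists>t M' ys' k'. t \<le> clen c \<and> Q M' ys' \<and> k' \<le> S \<and>
    (step P w x ^^ t) (config_of p M ys k) = config_of (p + clen c) M' ys' k'"
  using assms
proof (induction c arbitrary: p Q M ys k pre post)
  case Skip
  then show ?case by (auto intro!: exI[of _ "0::nat"])
next
  case (Ins i)
  from Ins.prems have "step P w x (config_of p M ys k) =
    config_of (p + 1) (new_mem w x i M) (new_output i M ys)
      (Max (insert k (Suc ` accessed M i)))"
    using step_at[of P pre i post p w x M ys k] by simp
  moreover have "Max (insert k (Suc ` accessed M i)) \<le> S"
    using Ins.prems by (intro Max_accessed_le) auto
  ultimately show ?case
    using Ins.prems(1) by (intro exI[of _ "1::nat"]) auto
next
  case (Seq c d)
  from Seq.IH(1)[of "wp w x S d Q" M ys k pre p "code (p + clen c) d @ post"] Seq.prems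
  obtain t1 M1 ys1 k1 where 1: "t1 \<le> clen c" "wp w x S d Q M1 ys1" "k1 \<le> S"
    "(step P w x ^^ t1) (config_of p M ys k) = config_of (p + clen c) M1 ys1 k1"
    by auto
  from Seq.IH(2)[of Q M1 ys1 k1 "pre @ code p c" "p + clen c" post] 1 Seq.prems
  obtain t2 M2 ys2 k2 where 2: "t2 \<le> clen d" "Q M2 ys2" "k2 \<le> S"
    "(step P w x ^^ t2) (config_of (p + clen c) M1 ys1 k1) =
       config_of (p + clen c + clen d) M2 ys2 k2"
    by auto
  have "(step P w x ^^ (t2 + t1)) (config_of p M ys k) =
      config_of (p + clen c + clen d) M2 ys2 k2"
    using 1(4) 2(4) by (simp add: funpow_add)
  then show ?case
    using 1 2 by (intro exI[of _ "t2 + t1"]) (auto simp: add.assoc)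
next
  case (IfNZ r c d)
  have "Max (insert k (Suc ` {r})) \<le> S"
    using IfNZ.prems by auto
  \<comment> \<open>The jump target 0 is a dummy: \<open>accessed\<close> ignores it.\<close>
  then obtain k0 where k0: "k0 \<le> S" "k0 = Max (insert k (Suc ` accessed M (JumpZero r 0)))"
    by auto
  have jz: "step P w x (config_of p M ys k) =
      config_of (if M r = 0 then p + clen c + 2 else p + 1) M ys k0"
    using IfNZ.prems k0(2) by (subst step_at) auto
  show ?case
  proof (cases "M r = 0")
    case True
    from IfNZ.IH(2)[of Q M ys k0 "pre @ JumpZero r (p + clen c + 2) # code (p + 1) c @
        [Jump (p + clen c + clen d + 2)]" "p + clen c + 2" post] IfNZ.prems k0(1) True
    obtain t2 M2 ys2 k2 where 2: "t2 \<le> clen d" "Q M2 ys2" "k2 \<le> S"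
      "(step P w x ^^ t2) (config_of (p + clen c + 2) M ys k0) =
         config_of (p + clen c + 2 + clen d) M2 ys2 k2"
      by auto
    have "(step P w x ^^ (Suc t2)) (config_of p M ys k) =
        config_of (p + clen (IfNZ r c d)) M2 ys2 k2"
      using 2(4) jz True by (simp add: funpow_Suc_right add_ac del: funpow.simps)
    then show ?thesis
      using 2 by (intro exI[of _ "Suc t2"]) auto
  next
    case False
    from IfNZ.IH(1)[of Q M ys k0 "pre @ [JumpZero r (p + clen c + 2)]" "p + 1"
        "Jump (p + clen c + clen d + 2) # code (p + clen c + 2) d @ post"]
      IfNZ.prems k0(1) False
    obtain t2 M2 ys2 k2 where 2: "t2 \<le> clen c" "Q M2 ys2" "k2 \<le> S"
      "(step P w x ^^ t2) (config_of (p + 1) M ys k0) =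
         config_of (p + 1 + clen c) M2 ys2 k2"
      by auto
    have j: "step P w x (config_of (p + 1 + clen c) M2 ys2 k2) =
        config_of (p + clen (IfNZ r c d)) M2 ys2 k2"
      using IfNZ.prems
      by (subst step_at[of _ "pre @ JumpZero r (p + clen c + 2) # code (p + 1) c"]) auto
    have "(step P w x ^^ (Suc (t2 + 1))) (config_of p M ys k) =
        config_of (p + clen (IfNZ r c d)) M2 ys2 k2"
      using 2(4) jz j False
      by (simp only: funpow_Suc_right funpow_add o_apply add.commute[of t2]) simp
    then show ?thesis
      using 2 by (intro exI[of _ "Suc (t2 + 1)"]) auto
  qed
qed

text \<open>A setup followed by a while loop on cell \<open>r\<close>; the exit jump leads just past
  the last instruction, where the program has halted.\<close>

definition loop_program :: "com \<Rightarrow> nat \<Rightarrow> com \<Rightarrow> program" where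
  "loop_program c r d =
     code 0 c @ JumpZero r (clen c + clen d + 2) # code (clen c + 1) d @ [Jump (clen c)]"

text \<open>
  \<open>reaches w x S r d k Q\<close>: at most \<open>k\<close> iterations of the loop ``while cell \<open>r\<close> is nonzero
  do \<open>d\<close>'' lead to a state with the property \<open>Q\<close> at the head of the loop.
\<close>

fun reaches :: "nat \<Rightarrow> nat list \<Rightarrow> nat \<Rightarrow> nat \<Rightarrow> com \<Rightarrow> nat \<Rightarrow>
    ((nat \<Rightarrow> nat) \<Rightarrow> nat list \<Rightarrow> bool) \<Rightarrow> (nat \<Rightarrow> nat) \<Rightarrow> nat list \<Rightarrow> bool" where
  "reaches w x S r d 0 Q M ys = Q M ys"
| "reaches w x S r d (Suc k) Q M ys \<longleftrightarrow>
     Q M ys \<or> M r \<noteq> 0 \<and> wp w x S d (reaches w x S r d k Q) M ys"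

text \<open>The number of iterations is only an upper bound, so what the first phase leaves unspent
  can be carried along; \<open>mono\<close> and \<open>more\<close> add the surplus.\<close>

lemma reaches_trans:
  assumes "reaches w x S r d k Q M ys" and "\<And>M ys. Q M ys \<Longrightarrow> reaches w x S r d j R M ys"
  shows "reaches w x S r d (k + j) R M ys"
  using assms(1)
proof (induction k arbitrary: M ys)
  case 0
  then show ?case using assms(2) by simp
next
  case (Suc k)
  have mono: "reaches w x S r d (Suc m) R M ys" if "reaches w x S r d m R M ys" for m M ys
    using that
  proof (induction m arbitrary: M ys)
    case (Suc m)
    then show ?case
      using wp_mono[of w x S d "reaches w x S r d m R" M ys "reaches w x S r d (Suc m) R"] by auto
  qed simp
  have more: "reaches w x S r d (m + i) R M ys" if "reaches w x S r d m R M ys" for m i M ys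
    by (induction i) (use that mono in auto)
  show ?case
  proof (cases "Q M ys")
    case True
    then show ?thesis
      using more[OF assms(2), of M ys "Suc k"] by (simp only: add.commute)
  next
    case False
    then have "M r \<noteq> 0" "wp w x S d (reaches w x S r d k Q) M ys"
      using Suc.prems by auto
    moreover from this(2) have "wp w x S d (reaches w x S r d (k + j) R) M ys"
      by (rule wp_mono) (rule Suc.IH)
    ultimately show ?thesis by simp
  qed
qed

lemma reaches_mono:
  assumes "reaches w x S r d k Q M ys" and "\<And>M ys. Q M ys \<Longrightarrow> R M ys"
  shows "reaches w x S r d k R M ys"
  using reaches_trans[OF assms(1), of 0 R] assms(2) by simp

lemma reaches_le:
  assumes "reaches w x S r d k Q M ys" "k \<le> j"
  shows "reaches w x S r d j Q M ys"
proof -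
  have refl: "reaches w x S r d m Q M ys" if "Q M ys" for m M ys
    using that by (cases m) auto
  show ?thesis
    using reaches_trans[OF assms(1) refl, of "j - k"] assms(2) by simp
qed

text \<open>Besides the body, an iteration executes the loop test and the jump back, hence
  \<open>clen d + 2\<close>.\<close>

lemma reaches_correct:
  assumes "reaches w x S r d k Q M ys" "m \<le> S" "r < S" "P = loop_program c r d"
  shows "\<exists>t M' ys' m'. t \<le> k * (clen d + 2) \<and> Q M' ys' \<and> m' \<le> S \<and>
    (step P w x ^^ t) (config_of (clen c) M ys m) = config_of (clen c) M' ys' m'"
  using assms(1,2)
proof (induction k arbitrary: M ys m)
  case 0
  then show ?case by (auto intro!: exI[of _ "0::nat"])
next
  case (Suc k)
  show ?case
  proof (cases "Q M ys")
    case True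
    then show ?thesis using Suc.prems by (intro exI[of _ "0::nat"]) auto
  next
    case False
    then have r: "M r \<noteq> 0" and body: "wp w x S d (reaches w x S r d k Q) M ys"
      using Suc.prems by auto
    define m0 where "m0 = Max (insert m (Suc ` accessed M (JumpZero r 0)))"
    have "m0 \<le> S"
      unfolding m0_def using assms(3) Suc.prems(2) by (intro Max_accessed_le) auto
    have jz: "step P w x (config_of (clen c) M ys m) = config_of (clen c + 1) M ys m0"
      using r unfolding assms(4) loop_program_def m0_def
      by (subst step_at[of _ "code 0 c"]) auto
    from code_correct[OF body \<open>m0 \<le> S\<close>, of P
        "code 0 c @ [JumpZero r (clen c + clen d + 2)]" "clen c + 1" "[Jump (clen c)]"]
    obtain t1 M1 ys1 m1 where 1: "t1 \<le> clen d" "reaches w x S r d k Q M1 ys1" "m1 \<le> S"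
      "(step P w x ^^ t1) (config_of (clen c + 1) M ys m0) =
         config_of (clen c + 1 + clen d) M1 ys1 m1"
      by (auto simp: assms(4) loop_program_def)
    have j: "step P w x (config_of (clen c + 1 + clen d) M1 ys1 m1) =
        config_of (clen c) M1 ys1 m1"
      unfolding assms(4) loop_program_def
      by (subst step_at[of _ "code 0 c @ JumpZero r (clen c + clen d + 2) #
            code (clen c + 1) d" _ "[]"]) auto
    from Suc.IH[OF 1(2,3)]
    obtain t2 M2 ys2 m2 where 2: "t2 \<le> k * (clen d + 2)" "Q M2 ys2" "m2 \<le> S"
      "(step P w x ^^ t2) (config_of (clen c) M1 ys1 m1) = config_of (clen c) M2 ys2 m2"
      by auto
    have "(step P w x ^^ (t2 + Suc (t1 + 1))) (config_of (clen c) M ys m) =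
        config_of (clen c) M2 ys2 m2"
      unfolding funpow_add o_apply using jz 1(4) j 2(4)
      by (simp only: funpow_Suc_right funpow_add o_apply add.commute[of t1]) simp
    then show ?thesis
      using 1 2 by (intro exI[of _ "t2 + Suc (t1 + 1)"]) auto
  qed
qed

section \<open>Runs of complete programs\<close>

lemma halted_funpow_step: "halted P s \<Longrightarrow> (step P w x ^^ t) s = s"
  by (induction t) (auto simp: step_def)

text \<open>\<open>runs\<close> asks for the first halting time; from then on the configuration is
  constant, so output and space agree with those at time \<open>t\<close>.\<close>

lemma runs_if_halted:
  assumes "halted P (config_at P w x t)" "written (config_at P w x t) = ys"
    "cells (config_at P w x t) \<le> S"
  shows "\<exists>t' b. t' \<le> t \<and> b \<le> w * S \<and> runs P w x ys t' b"
proof -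
  define t' where "t' = (LEAST t. halted P (config_at P w x t))"
  have h: "halted P (config_at P w x t')" and le: "t' \<le> t"
    unfolding t'_def using assms(1) by (auto intro: LeastI Least_le)
  have "config_at P w x (t - t' + t') = config_at P w x t'"
    using halted_funpow_step[OF h] unfolding config_at_def by (simp add: funpow_add)
  then have eq: "config_at P w x t = config_at P w x t'"
    using le by simp
  have "\<forall>t''<t'. \<not> halted P (config_at P w x t'')"
    unfolding t'_def using not_less_Least by blast
  then have "runs P w x ys t' (w * cells (config_at P w x t'))"
    using h assms(2) eq by (simp add: runs_def)
  moreover have "w * cells (config_at P w x t') \<le> w * S"
    using assms(3) eq by simp
  ultimately show ?thesis
    using le by blast
qed

text \<open>The additional step is the final loop test, which finds cell \<open>r\<close>
  zero.\<close>

lemma loop_program_runs: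
  assumes c: "wp w x S c (reaches w x S r d k (\<lambda>M zs. M r = 0 \<and> zs = ys)) (\<lambda>_. 0) []"
    and "r < S"
  shows "\<exists>t b. t \<le> clen c + k * (clen d + 2) + 1 \<and> b \<le> w * S \<and>
    runs (loop_program c r d) w x ys t b"
proof -
  let ?P = "loop_program c r d"
  from code_correct[OF c, of 0 ?P "[]" 0 "drop (clen c) ?P"]
  obtain t1 M1 ys1 m1 where 1: "t1 \<le> clen c"
    "reaches w x S r d k (\<lambda>M zs. M r = 0 \<and> zs = ys) M1 ys1" "m1 \<le> S"
    "(step ?P w x ^^ t1) init_config = config_of (clen c) M1 ys1 m1"
    by (auto simp: loop_program_def init_config_def)
  from reaches_correct[OF 1(2,3) assms(2) refl, of c]
  obtain t2 M2 m2 where 2: "t2 \<le> k * (clen d + 2)" "M2 r = 0" "m2 \<le> S"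
    "(step ?P w x ^^ t2) (config_of (clen c) M1 ys1 m1) = config_of (clen c) M2 ys m2"
    by auto
  define m where "m = Max (insert m2 (Suc ` accessed M2 (JumpZero r 0)))"
  have "m \<le> S"
    unfolding m_def using assms(2) 2(3) by (intro Max_accessed_le) auto
  have jz: "step ?P w x (config_of (clen c) M2 ys m2) =
      config_of (clen c + clen d + 2) M2 ys m"
    using 2(2) unfolding loop_program_def m_def by (subst step_at[of _ "code 0 c"]) auto
  have "config_at ?P w x (1 + t2 + t1) = config_of (clen c + clen d + 2) M2 ys m"
    unfolding config_at_def funpow_add o_apply 1(4) 2(4) using jz by simp
  with runs_if_halted[of ?P w x "1 + t2 + t1" ys S] \<open>m \<le> S\<close> 1(1) 2(1)
  obtain t b where "t \<le> 1 + t2 + t1" "b \<le> w * S" "runs ?P w x ys t b"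
    by (auto simp: halted_def loop_program_def)
  then show ?thesis
    using 1(1) 2(1) by (intro exI[of _ t] exI[of _ b]) auto
qed

section \<open>The program\<close>

text \<open>
  Cell 0 holds \<open>n\<close>, cell 1 the maximum degree, cell 2 the current vertex of the outermost loop,
  cell 3 the mode (0 stops the program), cell 4 the level of the recursion, cell 5 the argument
  of a call or the returned value, cell 14 the constant 1; cells 10--13, 15 and 16 are scratch.
  The frame of level \<open>l\<close> occupies the four cells from \<open>20 + 4 * l\<close> and is copied to cells 6--9.
  A frame \<open>(p, b, u, s)\<close> at level \<open>l\<close> belongs to the evaluation of \<open>saturated\<close> at \<open>p\<close> and \<open>b\<close> in
  stage \<open>l - 1\<close>: all vertices below \<open>u\<close> have been examined without deciding the answer, and \<open>s\<close> is
  the value to return in case the answer is positive. The flag \<open>s\<close> replaces the negated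
  recursive call of \<open>saturated\<close> by a jump.
\<close>

definition copy :: "nat \<Rightarrow> nat \<Rightarrow> com" where
  "copy d a = Ins (Bin Or d a a)"

definition frame_address :: com where
  "frame_address =
     Ins (Const 15 4) ;; Ins (Bin Mul 15 15 4) ;; Ins (Const 11 20) ;; Ins (Bin Add 15 15 11)"

definition load_frame :: com where
  "load_frame = frame_address ;;
     Ins (Load 6 15) ;; Ins (Bin Add 15 15 14) ;;
     Ins (Load 7 15) ;; Ins (Bin Add 15 15 14) ;;
     Ins (Load 8 15) ;; Ins (Bin Add 15 15 14) ;;
     Ins (Load 9 15)"

definition store_frame :: com where
  "store_frame = frame_address ;;
     Ins (Store 15 6) ;; Ins (Bin Add 15 15 14) ;;
     Ins (Store 15 7) ;; Ins (Bin Add 15 15 14) ;;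
     Ins (Store 15 8) ;; Ins (Bin Add 15 15 14) ;;
     Ins (Store 15 9)"

text \<open>Cell 13 holds the vertex; level \<open>l\<close> works in stage \<open>l - 1\<close>,
  hence the subtraction. If the list is too short the result is 0, which never exceeds a vertex and
  so is never mistaken for a target.\<close>

definition find_target :: com where
  "find_target =
     Ins (Bin Add 11 13 14) ;; Ins (Read 12 11) ;;
     Ins (Bin Add 11 11 14) ;; Ins (Read 11 11) ;;
     Ins (Bin Add 12 12 4) ;; Ins (Bin Sub 12 12 14) ;;
     Ins (Const 10 0) ;; Ins (Bin Less 11 12 11) ;;
     IfNZ 11 (Ins (Read 10 12)) Skip"

text \<open>The maximum degree is not part of the input, but it is the level at which the recursion
  starts.\<close>

definition degree_mode :: com where
  "degree_mode =
     Ins (Bin Less 12 2 0) ;;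
     IfNZ 12
       (Ins (Bin Add 11 2 14) ;; Ins (Read 12 11) ;;
        Ins (Bin Add 11 11 14) ;; Ins (Read 11 11) ;; Ins (Bin Sub 11 11 12) ;;
        Ins (Bin Less 12 1 11) ;; IfNZ 12 (copy 1 11) Skip ;;
        Ins (Bin Add 2 2 14))
       (Ins (Const 2 0) ;; Ins (Const 3 2))"

definition next_mode :: com where
  "next_mode =
     Ins (Bin Less 12 2 0) ;;
     IfNZ 12 (copy 4 1 ;; copy 5 2 ;; Ins (Const 3 3)) (Ins (Const 3 0))"

definition call_mode :: com where
  "call_mode =
     IfNZ 4
       (copy 6 5 ;; copy 7 0 ;; Ins (Const 8 0) ;; Ins (Const 9 1) ;; store_frame ;;
        Ins (Const 3 4))
       (Ins (Const 5 0) ;; Ins (Const 4 1) ;; Ins (Const 3 5))"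

text \<open>The products and the sum encode conjunction and disjunction in the test whether to query
  \<open>u\<close>. Once all vertices are examined, \<open>s\<close> is flipped in both cases: to
  report a negative answer, or to account for the negation when the walk moves up.\<close>

definition scan_mode :: com where
  "scan_mode =
     load_frame ;; Ins (Bin Less 16 8 0) ;; IfNZ 16 (copy 13 8) (copy 13 6) ;;
     find_target ;;
     IfNZ 16
       (Ins (Bin Less 12 8 10) ;; Ins (Bin Equal 11 10 6) ;; Ins (Bin Mul 12 12 11) ;;
        Ins (Bin Less 11 8 7) ;; Ins (Bin Mul 12 12 11) ;;
        Ins (Bin Equal 11 8 6) ;; Ins (Bin Add 12 12 11) ;;
        IfNZ 12
          (copy 5 8 ;; Ins (Bin Sub 4 4 14) ;; Ins (Const 3 3))
          (Ins (Bin Add 8 8 14) ;; store_frame))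
       (Ins (Bin Sub 9 14 9) ;; Ins (Bin Less 12 6 10) ;;
        IfNZ 12
          (copy 7 6 ;; copy 6 10 ;; Ins (Const 8 0) ;; store_frame)
          (copy 5 9 ;; Ins (Bin Add 4 4 14) ;; Ins (Const 3 5)))"

text \<open>Cell 4 has already been raised to the level of the caller, so a value above
  \<open>\<Delta>\<close> means that the outermost call is done. Otherwise the answer is decided if
  the bit \<open>u = p\<close> equals the returned bit.\<close>

definition return_mode :: com where
  "return_mode =
     Ins (Bin Less 12 1 4) ;;
     IfNZ 12
       (IfNZ 5 (Ins (Write 2)) Skip ;; Ins (Bin Add 2 2 14) ;; Ins (Const 3 2))
       (load_frame ;; Ins (Bin Equal 11 8 6) ;; Ins (Bin Equal 12 11 5) ;;
        IfNZ 12
          (copy 5 9 ;; Ins (Bin Add 4 4 14))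
          (Ins (Bin Add 8 8 14) ;; store_frame ;; Ins (Const 3 4)))"

text \<open>Cell 1 is still zero and thus addresses input cell 0, which holds \<open>n\<close>.
  Cells 1 and 2 keep their zeros as the initial values of the degree loop.\<close>

definition setup_code :: com where
  "setup_code = Ins (Const 14 1) ;; Ins (Read 0 1) ;; Ins (Const 3 1)"

definition on_mode :: "nat \<Rightarrow> com \<Rightarrow> com \<Rightarrow> com" where
  "on_mode m c d = Ins (Const 12 m) ;; Ins (Bin Equal 12 3 12) ;; IfNZ 12 c d"

definition main_body :: com where
  "main_body = on_mode 1 degree_mode (on_mode 2 next_mode (on_mode 3 call_mode
     (on_mode 4 scan_mode return_mode)))"

text \<open>The view of the input array on which the correctness of the program rests.
  \<open>word_bound\<close> leaves room for offsets, vertices, frame addresses and constants, so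
  that no addition or multiplication wraps around.\<close>

locale graph_input =
  fixes w :: nat and x :: "nat list" and n :: nat and off deg :: "nat \<Rightarrow> nat"
    and nb :: "nat \<Rightarrow> nat \<Rightarrow> nat" and \<Delta> :: nat
  assumes input_n: "input_word w x 0 = n"
    and input_off: "v \<le> n \<Longrightarrow> input_word w x (Suc v) = off v"
    and off_Suc: "v < n \<Longrightarrow> off (Suc v) = off v + deg v"
    and input_nb: "v < n \<Longrightarrow> i < deg v \<Longrightarrow> input_word w x (off v + i) = nb v i"
    and nb_less: "v < n \<Longrightarrow> i < deg v \<Longrightarrow> nb v i < n"
    and word_bound: "v \<le> n \<Longrightarrow> off v + n + 4 * \<Delta> + 100 < 2 ^ w"
    and \<Delta>_eq: "\<Delta> = Max (insert 0 (deg ` {..<n}))"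
begin

definition target :: "nat \<Rightarrow> nat \<Rightarrow> nat" where
  "target i v = (if i < deg v then nb v i else 0)"

text \<open>The highest frame, that of level \<open>\<Delta>\<close>, ends in cell
  \<open>23 + 4 * \<Delta>\<close>.\<close>

definition S :: nat where "S = 24 + 4 * \<Delta>"

abbreviation "WP \<equiv> wp w x S"

lemma bound: "n + 4 * \<Delta> + 100 < 2 ^ w"
  using word_bound[of 0] by simp

lemma S_numeral: "k < 24 \<Longrightarrow> k < S"
  by (simp add: S_def)

section \<open>Overflow-free rules for symbolic execution\<close>

lemma WP_Const: "d < S \<Longrightarrow> k < 100 \<Longrightarrow> WP (Ins (Const d k)) Q M ys = Q (M(d := k)) ys"
  using bound by simp

lemma WP_Add: "d < S \<Longrightarrow> a < S \<Longrightarrow> b < S \<Longrightarrow> M a + M b < 2 ^ w \<Longrightarrow>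
    WP (Ins (Bin Add d a b)) Q M ys = Q (M(d := M a + M b)) ys"
  by simp

lemma WP_Mul: "d < S \<Longrightarrow> a < S \<Longrightarrow> b < S \<Longrightarrow> M a * M b < 2 ^ w \<Longrightarrow>
    WP (Ins (Bin Mul d a b)) Q M ys = Q (M(d := M a * M b)) ys"
  by simp

lemma WP_Sub: "d < S \<Longrightarrow> a < S \<Longrightarrow> b < S \<Longrightarrow> M b \<le> M a \<Longrightarrow> M a < 2 ^ w \<Longrightarrow>
    WP (Ins (Bin Sub d a b)) Q M ys = Q (M(d := M a - M b)) ys"
  by (simp add: le_mod_geq)

lemma WP_Less: "d < S \<Longrightarrow> a < S \<Longrightarrow> b < S \<Longrightarrow>
    WP (Ins (Bin Less d a b)) Q M ys = Q (M(d := of_bool (M a < M b))) ys"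
  by simp

lemma WP_Equal: "d < S \<Longrightarrow> a < S \<Longrightarrow> b < S \<Longrightarrow>
    WP (Ins (Bin Equal d a b)) Q M ys = Q (M(d := of_bool (M a = M b))) ys"
  by simp

lemma WP_copy: "d < S \<Longrightarrow> a < S \<Longrightarrow> WP (copy d a) Q M ys = Q (M(d := M a)) ys"
  by (simp add: copy_def)

lemma WP_Load: "d < S \<Longrightarrow> a < S \<Longrightarrow> M a < S \<Longrightarrow>
    WP (Ins (Load d a)) Q M ys = Q (M(d := M (M a))) ys"
  by simp

lemma WP_Store: "a < S \<Longrightarrow> b < S \<Longrightarrow> M a < S \<Longrightarrow>
    WP (Ins (Store a b)) Q M ys = Q (M(M a := M b)) ys"
  by simp

lemma WP_Read: "d < S \<Longrightarrow> a < S \<Longrightarrow>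
    WP (Ins (Read d a)) Q M ys = Q (M(d := input_word w x (M a))) ys"
  by simp

lemma WP_Write: "a < S \<Longrightarrow> WP (Ins (Write a)) Q M ys = Q M (ys @ [M a])"
  by simp

lemma WP_IfNZ: "r < S \<Longrightarrow>
    WP (IfNZ r c d) Q M ys = (if M r \<noteq> 0 then WP c Q M ys else WP d Q M ys)"
  by simp

lemma WP_on_mode: "m < 100 \<Longrightarrow> WP (on_mode m c d) Q M ys =
    (let M' = M(12 := of_bool (M 3 = m)) in if M 3 = m then WP c Q M' ys else WP d Q M' ys)"
  by (simp add: on_mode_def WP_Const WP_Equal S_numeral del: wp.simps(2))

lemmas WP_simps = WP_Const WP_Add WP_Mul WP_Sub WP_Less WP_Equal WP_copy WP_Load WP_Store WP_Read
  WP_Write WP_IfNZ wp.simps(1,3)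

declare wp.simps(2,4) [simp del]

text \<open>As a congruence rule this confines simplification to memory and output, so that code is
  executed symbolically one instruction at a time.\<close>

lemma wp_weak_cong:
  "M = M' \<Longrightarrow> ys = ys' \<Longrightarrow> wp v z T c Q M ys = wp v z T c Q M' ys'"
  by simp

lemma WP_load_frame:
  assumes "M 4 \<le> \<Delta>" "M 14 = 1"
  shows "WP load_frame Q M ys = Q (M(11 := 20, 15 := 23 + 4 * M 4, 6 := M (20 + 4 * M 4),
    7 := M (21 + 4 * M 4), 8 := M (22 + 4 * M 4), 9 := M (23 + 4 * M 4))) ys"
proof -
  have "4 * M 4 + 23 < S" "4 * M 4 + 23 < 2 ^ w"
    using assms bound by (auto simp: S_def)
  then show ?thesis
    using assms unfolding load_frame_def frame_address_def
    by (simp add: WP_simps S_numeral algebra_simps cong: wp_weak_cong)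
       (intro arg_cong[of _ _ "\<lambda>M. Q M ys"] ext, simp)
qed

lemma WP_store_frame:
  assumes "M 4 \<le> \<Delta>" "M 14 = 1"
  shows "WP store_frame Q M ys = Q (M(11 := 20, 15 := 23 + 4 * M 4, 20 + 4 * M 4 := M 6,
    21 + 4 * M 4 := M 7, 22 + 4 * M 4 := M 8, 23 + 4 * M 4 := M 9)) ys"
proof -
  have "4 * M 4 + 23 < S" "4 * M 4 + 23 < 2 ^ w"
    using assms bound by (auto simp: S_def)
  then show ?thesis
    using assms unfolding store_frame_def frame_address_def
    by (simp add: WP_simps S_numeral algebra_simps cong: wp_weak_cong)
       (intro arg_cong[of _ _ "\<lambda>M. Q M ys"] ext, simp)
qed

lemma WP_find_target:
  assumes "M 13 < n" "M 4 = Suc k" "k < \<Delta>" "M 14 = 1"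
  shows "WP find_target Q M ys = Q (M(11 := of_bool (k < deg (M 13)),
    12 := off (M 13) + k, 10 := target k (M 13))) ys"
proof -
  have b: "off (M 13) + n + 4 * \<Delta> + 100 < 2 ^ w"
    using word_bound assms by simp
  have i: "input_word w x (Suc (M 13)) = off (M 13)"
    "input_word w x (Suc (Suc (M 13))) = off (M 13) + deg (M 13)"
    using input_off[of "M 13"] input_off[of "Suc (M 13)"] off_Suc[of "M 13"] assms by auto
  have t: "k < deg (M 13) \<Longrightarrow> input_word w x (off (M 13) + k) = nb (M 13) k"
    using assms input_nb[of "M 13" k] by simp
  show ?thesis
    using assms b i t unfolding find_target_def
    by (simp add: WP_simps S_numeral target_def cong: wp_weak_cong)
       (intro conjI impI arg_cong[of _ _ "\<lambda>M. Q M ys"] ext, simp_all)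
qed

abbreviation "REACHES \<equiv> reaches w x S 3 main_body"

lemma reaches_step:
  assumes "M 3 \<noteq> 0" "WP main_body Q M ys"
  shows "REACHES 1 Q M ys"
proof -
  have "reaches w x S 3 main_body 0 Q = Q"
    by (intro ext) simp
  then show ?thesis
    using assms by (simp add: reaches.simps(2))
qed

declare reaches.simps(2) [simp del]

lemma reaches_mode:
  shows reaches_degree: "M 3 = 1 \<Longrightarrow> WP degree_mode Q (M(12 := 1)) ys \<Longrightarrow> REACHES 1 Q M ys"
    and reaches_next: "M 3 = 2 \<Longrightarrow> WP next_mode Q (M(12 := 1)) ys \<Longrightarrow> REACHES 1 Q M ys"
    and reaches_call: "M 3 = 3 \<Longrightarrow> WP call_mode Q (M(12 := 1)) ys \<Longrightarrow> REACHES 1 Q M ys"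
    and reaches_scan: "M 3 = 4 \<Longrightarrow> WP scan_mode Q (M(12 := 1)) ys \<Longrightarrow> REACHES 1 Q M ys"
    and reaches_return: "M 3 = 5 \<Longrightarrow> WP return_mode Q (M(12 := 0)) ys \<Longrightarrow> REACHES 1 Q M ys"
  by (rule reaches_step, simp, simp add: main_body_def WP_on_mode)+

text \<open>
  In the following state descriptions, \<open>H\<close> records the frames of the callers, which a call must
  leave unchanged; the frames of lower levels are arbitrary.
\<close>

definition in_degree :: "nat \<Rightarrow> nat \<Rightarrow> (nat \<Rightarrow> nat) \<Rightarrow> bool" where
  "in_degree d v M \<longleftrightarrow> M 0 = n \<and> M 14 = 1 \<and> M 1 = d \<and> M 2 = v \<and> M 3 = 1"

definition globals :: "nat \<Rightarrow> (nat \<Rightarrow> nat) \<Rightarrow> bool" where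
  "globals v M \<longleftrightarrow> M 0 = n \<and> M 14 = 1 \<and> M 1 = \<Delta> \<and> M 2 = v"

definition in_next :: "nat \<Rightarrow> (nat \<Rightarrow> nat) \<Rightarrow> bool" where
  "in_next v M \<longleftrightarrow> globals v M \<and> M 3 = 2"

definition in_call :: "nat \<Rightarrow> nat \<Rightarrow> nat \<Rightarrow> (nat \<Rightarrow> nat) \<Rightarrow> (nat \<Rightarrow> nat) \<Rightarrow> bool" where
  "in_call v l a H M \<longleftrightarrow> globals v M \<and> M 3 = 3 \<and> M 4 = l \<and> M 5 = a \<and>
     (\<forall>k\<ge>24 + 4 * l. M k = H k)"

definition frame :: "nat \<Rightarrow> nat \<Rightarrow> nat \<Rightarrow> nat \<Rightarrow> bool \<Rightarrow> (nat \<Rightarrow> nat) \<Rightarrow> bool" where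
  "frame l p b u s M \<longleftrightarrow> M (20 + 4 * l) = p \<and> M (21 + 4 * l) = b \<and> M (22 + 4 * l) = u \<and>
     M (23 + 4 * l) = of_bool s"

definition in_scan :: "nat \<Rightarrow> nat \<Rightarrow> nat \<Rightarrow> nat \<Rightarrow> nat \<Rightarrow> bool \<Rightarrow> (nat \<Rightarrow> nat) \<Rightarrow>
    (nat \<Rightarrow> nat) \<Rightarrow> bool" where
  "in_scan v l p b u s H M \<longleftrightarrow> globals v M \<and> M 3 = 4 \<and> M 4 = l \<and> frame l p b u s M \<and>
     (\<forall>k\<ge>24 + 4 * l. M k = H k)"

text \<open>Here \<open>l\<close> is the level of the resuming caller, one above the finished call,
  and the preserved cells begin with the frame of that caller.\<close>

definition in_return :: "nat \<Rightarrow> nat \<Rightarrow> bool \<Rightarrow> (nat \<Rightarrow> nat) \<Rightarrow> (nat \<Rightarrow> nat) \<Rightarrow> bool" where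
  "in_return v l r H M \<longleftrightarrow> globals v M \<and> M 3 = 5 \<and> M 4 = l \<and> M 5 = of_bool r \<and>
     (\<forall>k\<ge>20 + 4 * l. M k = H k)"

lemmas state_defs = in_degree_def globals_def in_next_def in_call_def frame_def in_scan_def
  in_return_def

section \<open>Single iterations of the main loop\<close>

lemma degree_step:
  assumes "in_degree d v M" "v < n"
  shows "REACHES 1 (\<lambda>M' ys'. ys' = ys \<and> in_degree (max d (deg v)) (Suc v) M') M ys"
proof -
  have b: "off v + n + 4 * \<Delta> + 100 < 2 ^ w" "off v + deg v + n + 4 * \<Delta> + 100 < 2 ^ w"
    using word_bound[of v] word_bound[of "Suc v"] off_Suc assms by auto
  have i: "input_word w x (Suc v) = off v" "input_word w x (Suc (Suc v)) = off v + deg v"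
    using input_off[of v] input_off[of "Suc v"] off_Suc[of v] assms by auto
  show ?thesis
    using assms b i
    by (intro reaches_degree[unfolded degree_mode_def])
     (simp_all add: state_defs WP_simps S_numeral cong: wp_weak_cong)
qed

lemma degree_end:
  assumes "in_degree \<Delta> n M"
  shows "REACHES 1 (\<lambda>M' ys'. ys' = ys \<and> in_next 0 M') M ys"
  using assms
  by (intro reaches_degree[unfolded degree_mode_def])
     (simp_all add: state_defs WP_simps S_numeral cong: wp_weak_cong)

text \<open>The outermost call has no caller to protect, so the memory reached serves as
  \<open>H\<close>.\<close>

lemma next_step:
  assumes "in_next v M" "v < n"
  shows "REACHES 1 (\<lambda>M' ys'. ys' = ys \<and> in_call v \<Delta> v M' M') M ys"
  using assms
  by (intro reaches_next[unfolded next_mode_def])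
     (simp_all add: state_defs WP_simps S_numeral cong: wp_weak_cong)

lemma next_end:
  assumes "in_next n M"
  shows "REACHES 1 (\<lambda>M' ys'. M' 3 = 0 \<and> ys' = ys) M ys"
  using assms
  by (intro reaches_next[unfolded next_mode_def])
     (simp_all add: state_defs WP_simps S_numeral cong: wp_weak_cong)

lemma call_bottom:
  assumes "in_call v 0 a H M"
  shows "REACHES 1 (\<lambda>M' ys'. ys' = ys \<and> in_return v 1 False H M') M ys"
  using assms
  by (intro reaches_call[unfolded call_mode_def])
     (simp_all add: state_defs WP_simps S_numeral cong: wp_weak_cong)

lemma call_step:
  assumes "in_call v (Suc l) a H M" "l < \<Delta>"
  shows "REACHES 1 (\<lambda>M' ys'. ys' = ys \<and> in_scan v (Suc l) a n 0 True H M') M ys"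
  using assms
  by (intro reaches_call[unfolded call_mode_def])
     (simp_all add: state_defs WP_simps WP_store_frame S_numeral cong: wp_weak_cong)

lemma return_top:
  assumes "in_return v (Suc \<Delta>) r H M" "v < n"
  shows "REACHES 1 (\<lambda>M' ys'. ys' = (if r then ys @ [v] else ys) \<and> in_next (Suc v) M') M ys"
  using assms bound
  by (intro reaches_return[unfolded return_mode_def])
     (simp_all add: state_defs WP_simps WP_store_frame S_numeral cong: wp_weak_cong)

lemma return_hit:
  assumes "in_return v (Suc l) r H M" "l < \<Delta>" "frame (Suc l) p b u s H" "(u = p) = r"
  shows "REACHES 1 (\<lambda>M' ys'. ys' = ys \<and> in_return v (Suc (Suc l)) s H M') M ys"
  using assms bound
  by (intro reaches_return[unfolded return_mode_def])
     (simp_all add: state_defs WP_simps WP_load_frame S_numeral cong: wp_weak_cong)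

lemma return_miss:
  assumes "in_return v (Suc l) r H M" "l < \<Delta>" "frame (Suc l) p b u s H" "(u = p) \<noteq> r" "u < n"
  shows "REACHES 1 (\<lambda>M' ys'. ys' = ys \<and> in_scan v (Suc l) p b (Suc u) s H M') M ys"
  using assms bound
  by (intro reaches_return[unfolded return_mode_def])
     (simp_all add: state_defs WP_simps WP_load_frame WP_store_frame S_numeral
        cong: wp_weak_cong)

text \<open>The memory at the moment of the call becomes the new \<open>H\<close>, so the frame of
  level \<open>Suc l\<close> survives the call.\<close>

lemma scan_call:
  assumes "in_scan v (Suc l) p b u s H M" "l < \<Delta>" "u < n"
    "u = p \<or> u < b \<and> u < p \<and> target l u = p"
  shows "REACHES 1 (\<lambda>M' ys'. ys' = ys \<and> in_call v l u M M') M ys"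
  using assms bound
  by (intro reaches_scan[unfolded scan_mode_def], simp_all add: state_defs WP_simps WP_load_frame WP_find_target S_numeral
        cong: wp_weak_cong, auto)

lemma scan_skip:
  assumes "in_scan v (Suc l) p b u s H M" "l < \<Delta>" "u < n"
    "\<not> (u = p \<or> u < b \<and> u < p \<and> target l u = p)"
  shows "REACHES 1 (\<lambda>M' ys'. ys' = ys \<and> in_scan v (Suc l) p b (Suc u) s H M') M ys"
  using assms bound
  by (intro reaches_scan[unfolded scan_mode_def], simp_all add: state_defs WP_simps WP_load_frame WP_store_frame WP_find_target
        S_numeral cong: wp_weak_cong, auto)

text \<open>The frame is overwritten at the same level, so the walk towards the root consumes no
  space.\<close>

lemma scan_up:
  assumes "in_scan v (Suc l) p b n s H M" "l < \<Delta>" "p < n" "p < target l p"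
  shows "REACHES 1 (\<lambda>M' ys'. ys' = ys \<and> in_scan v (Suc l) (target l p) p 0 (\<not> s) H M') M ys"
  using assms bound
  by (intro reaches_scan[unfolded scan_mode_def])
     (simp_all add: state_defs WP_simps WP_load_frame WP_store_frame WP_find_target
        S_numeral cong: wp_weak_cong)

lemma scan_end:
  assumes "in_scan v (Suc l) p b n s H M" "l < \<Delta>" "p < n" "\<not> p < target l p"
  shows "REACHES 1 (\<lambda>M' ys'. ys' = ys \<and> in_return v (Suc (Suc l)) (\<not> s) H M') M ys"
  using assms bound
  by (intro reaches_scan[unfolded scan_mode_def])
     (simp_all add: state_defs WP_simps WP_load_frame WP_store_frame WP_find_target
        S_numeral cong: wp_weak_cong)

lemma in_return_trans:
  "in_return v l r H M \<Longrightarrow> (\<And>k. k \<ge> 20 + 4 * l \<Longrightarrow> H k = H' k) \<Longrightarrow> in_return v l r H' M"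
  by (simp add: in_return_def)

lemma in_scan_trans:
  "in_scan v l p b u s H M \<Longrightarrow> (\<And>k. k \<ge> 24 + 4 * l \<Longrightarrow> H k = H' k) \<Longrightarrow>
    in_scan v l p b u s H' M"
  by (simp add: in_scan_def)

section \<open>Correctness and iteration counts of the recursion\<close>

abbreviation mat :: "nat \<Rightarrow> nat \<Rightarrow> bool" where
  "mat \<equiv> matched n target"

text \<open>
  The queries made for a frame are about \<open>p\<close> itself and about its children below \<open>b\<close>; the former
  decides the answer if it is positive, the latter if they are negative.
\<close>

definition candidate :: "nat \<Rightarrow> nat \<Rightarrow> nat \<Rightarrow> nat \<Rightarrow> bool" where
  "candidate l p b u \<longleftrightarrow> u = p \<or> u < b \<and> u < p \<and> target l u = p"

definition witness :: "nat \<Rightarrow> nat \<Rightarrow> nat \<Rightarrow> nat \<Rightarrow> bool" where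
  "witness l p b u \<longleftrightarrow> candidate l p b u \<and> (u = p) = mat l u"

lemma saturated_witness:
  assumes "p < n" "b \<le> n"
  shows "saturated n (target l) (mat l) p b \<longleftrightarrow> (\<exists>u<n. witness l p b u) \<or>
    p < target l p \<and> \<not> saturated n (target l) (mat l) (target l p) p"
proof -
  have t: "p < target l p \<Longrightarrow> target l p < n"
    using assms nb_less by (auto simp: target_def split: if_splits)
  have "(\<exists>u<n. witness l p b u) \<longleftrightarrow> mat l p \<or> (\<exists>u<b. u < p \<and> target l u = p \<and> \<not> mat l u)"
    using assms unfolding witness_def candidate_def
    by (metis less_irrefl order.strict_trans2)
  then show ?thesis
    using t by (subst saturated_unfold) blast
qed

text \<open>The outer induction follows the walk, the inner one the scan over \<open>u\<close>. A
  vertex \<open>u\<close> costs at most \<open>T + 2\<close> iterations: entering the call, running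
  it, resuming. Leaving the scan costs one, and each of at most \<open>n - 1 - p\<close> further
  vertices of the walk costs a full scan.\<close>

lemma scan_correct:
  assumes call: "\<And>v a H M ys. in_call v l a H M \<Longrightarrow> a < n \<Longrightarrow>
      REACHES T (\<lambda>M' ys'. ys' = ys \<and> in_return v (Suc l) (mat l a) H M') M ys"
    and l: "l < \<Delta>"
  shows "in_scan v (Suc l) p b u s H M \<Longrightarrow> p < n \<Longrightarrow> b \<le> n \<Longrightarrow> u \<le> n \<Longrightarrow>
    (\<And>u'. u' < u \<Longrightarrow> \<not> witness l p b u') \<Longrightarrow>
    REACHES ((n - u) * (T + 2) + 1 + (n - 1 - p) * (n * (T + 2) + 1))
      (\<lambda>M' ys'. ys' = ys \<and>
        in_return v (Suc (Suc l)) (s = saturated n (target l) (mat l) p b) H M') M ys"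
proof (induction "n - p" arbitrary: p b u s M rule: less_induct)
  case outer: less
  define X where "X = (n - 1 - p) * (n * (T + 2) + 1)"
  let ?Q = "\<lambda>M' ys'. ys' = ys \<and>
    in_return v (Suc (Suc l)) (s = saturated n (target l) (mat l) p b) H M'"
  have "REACHES ((n - u) * (T + 2) + 1 + X) ?Q M ys"
    using outer.prems
  proof (induction "n - u" arbitrary: u M)
    case 0
    then have [simp]: "u = n" by simp
    have none: "\<not> (\<exists>u<n. witness l p b u)"
      using 0 by auto
    show ?case
    proof (cases "p < target l p")
      case True
      then have t: "target l p < n"
        using nb_less \<open>p < n\<close> by (auto simp: target_def split: if_splits)
      \<comment> \<open>Without a witness the answer at \<open>p\<close> is the negated answer at
        its target, which the flip of \<open>s\<close> compensates.\<close>
      have eq: "(\<not> s) = saturated n (target l) (mat l) (target l p) p \<longleftrightarrow>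
          s = saturated n (target l) (mat l) p b"
        using saturated_witness[of p b l] none True 0 by auto
      have up: "REACHES 1
          (\<lambda>M' ys'. ys' = ys \<and> in_scan v (Suc l) (target l p) p 0 (\<not> s) H M') M ys"
        using 0 True l by (intro scan_up) auto
      have "REACHES (1 + (n * (T + 2) + 1 + (n - 1 - target l p) * (n * (T + 2) + 1))) ?Q M ys"
      proof (rule reaches_trans[OF up], elim conjE)
        fix M' ys'
        assume "ys' = ys" and M': "in_scan v (Suc l) (target l p) p 0 (\<not> s) H M'"
        then show "REACHES (n * (T + 2) + 1 + (n - 1 - target l p) * (n * (T + 2) + 1)) ?Q M' ys'"
          using outer.hyps[OF _ M' t] True t by (simp add: eq)
      qed
      \<comment> \<open>The walk has moved strictly up, so one full scan can be paid from
        \<open>X\<close>.\<close>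
      moreover have "(n - 1 - target l p + 1) * (n * (T + 2) + 1) \<le> X"
        unfolding X_def using True t by (intro mult_le_mono1) simp
      then have "(n - 1 - target l p) * (n * (T + 2) + 1) + (n * (T + 2) + 1) \<le> X"
        by (simp only: add_mult_distrib mult_1)
      ultimately show ?thesis
        by (elim reaches_le) simp
    next
      case False
      then have "(s = saturated n (target l) (mat l) p b) = (\<not> s)"
        using saturated_witness[of p b l] none 0 by auto
      then have "REACHES 1 ?Q M ys"
        using scan_end[of v l p b s H M ys] 0 False l by simp
      then show ?thesis
        by (rule reaches_le) simp
    qed
  next
    case (Suc d)
    then have u: "u < n" by simp
    have budget: "(n - u) * (T + 2) + 1 + X = (T + 2) + ((n - Suc u) * (T + 2) + 1 + X)"
      using u by (simp add: Suc_diff_Suc[symmetric])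
    have rest: "REACHES ((n - Suc u) * (T + 2) + 1 + X) ?Q M' ys"
      if "in_scan v (Suc l) p b (Suc u) s H M'" "\<not> witness l p b u" for M'
      using Suc that u by (intro Suc.hyps(1)) (auto simp: less_Suc_eq)
    show ?case
    proof (cases "candidate l p b u")
      case False
      have "REACHES 1 (\<lambda>M' ys'. ys' = ys \<and> in_scan v (Suc l) p b (Suc u) s H M') M ys"
        using Suc.prems False l u by (intro scan_skip) (auto simp: candidate_def)
      then have "REACHES (1 + ((n - Suc u) * (T + 2) + 1 + X)) ?Q M ys"
        by (rule reaches_trans) (use rest False in \<open>auto simp: witness_def\<close>)
      then show ?thesis
        unfolding budget by (rule reaches_le) simp
    next
      case True
      have HM: "\<And>k. 24 + 4 * Suc l \<le> k \<Longrightarrow> M k = H k" and fr: "frame (Suc l) p b u s M"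
        using Suc.prems by (auto simp: in_scan_def)
      have "REACHES 1 (\<lambda>M' ys'. ys' = ys \<and> in_call v l u M M') M ys"
        using Suc.prems True l u by (intro scan_call) (auto simp: candidate_def)
      then have ret: "REACHES (1 + T)
          (\<lambda>M' ys'. ys' = ys \<and> in_return v (Suc l) (mat l u) M M') M ys"
        by (rule reaches_trans) (use call u in auto)
      have "REACHES (1 + T + (1 + ((n - Suc u) * (T + 2) + 1 + X))) ?Q M ys"
      proof (rule reaches_trans[OF ret], elim conjE)
        fix M' ys'
        assume M': "ys' = ys" "in_return v (Suc l) (mat l u) M M'"
        show "REACHES (1 + ((n - Suc u) * (T + 2) + 1 + X)) ?Q M' ys'"
        proof (cases "(u = p) = mat l u")
          case True
          then have "saturated n (target l) (mat l) p b"
            using \<open>candidate l p b u\<close> u Suc.prems saturated_witness[of p b l]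
            by (auto simp: witness_def)
          moreover from return_hit[OF M'(2) l fr True]
          have "REACHES 1 (\<lambda>M'' ys'. ys' = ys \<and> in_return v (Suc (Suc l)) s H M'') M' ys"
            by (rule reaches_mono) (auto elim: in_return_trans simp: HM)
          then have "REACHES (1 + ((n - Suc u) * (T + 2) + 1 + X))
              (\<lambda>M'' ys'. ys' = ys \<and> in_return v (Suc (Suc l)) s H M'') M' ys"
            by (rule reaches_le) simp
          ultimately show ?thesis
            using M'(1) by simp
        next
          case False
          then have "\<not> witness l p b u"
            by (simp add: witness_def)
          from return_miss[OF M'(2) l fr False u]
          have "REACHES 1 (\<lambda>M'' ys'. ys' = ys \<and> in_scan v (Suc l) p b (Suc u) s H M'') M' ys"
            by (rule reaches_mono) (auto elim: in_scan_trans simp: HM)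
          then show ?thesis
            unfolding M'(1) by (rule reaches_trans) (use rest \<open>\<not> witness l p b u\<close> in blast)
        qed
      qed
      then show ?thesis
        unfolding budget by (rule reaches_le) simp
    qed
  qed
  then show ?case
    by (simp add: X_def)
qed

text \<open>The outer factor \<open>n\<close> bounds the length of the walk, the inner one the
  vertices scanned at each of its stops.\<close>

fun call_time :: "nat \<Rightarrow> nat" where
  "call_time 0 = 1"
| "call_time (Suc l) = 1 + n * (n * (call_time l + 2) + 1)"

lemma call_correct:
  "in_call v l a H M \<Longrightarrow> a < n \<Longrightarrow> l \<le> \<Delta> \<Longrightarrow>
    REACHES (call_time l) (\<lambda>M' ys'. ys' = ys \<and> in_return v (Suc l) (mat l a) H M') M ys"
proof (induction l arbitrary: v a H M ys)
  case 0
  then show ?case using call_bottom[of v a H M ys] by simp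
next
  case (Suc l)
  let ?T = "call_time l"
  have "REACHES 1 (\<lambda>M' ys'. ys' = ys \<and> in_scan v (Suc l) a n 0 True H M') M ys"
    using Suc.prems by (intro call_step) auto
  then have "REACHES (1 + ((n - 0) * (?T + 2) + 1 + (n - 1 - a) * (n * (?T + 2) + 1)))
      (\<lambda>M' ys'. ys' = ys \<and> in_return v (Suc (Suc l))
        (True = saturated n (target l) (mat l) a n) H M') M ys"
  proof (rule reaches_trans, elim conjE)
    fix M' ys'
    assume "ys' = ys" "in_scan v (Suc l) a n 0 True H M'"
    then show "REACHES ((n - 0) * (?T + 2) + 1 + (n - 1 - a) * (n * (?T + 2) + 1))
      (\<lambda>M' ys'. ys' = ys \<and> in_return v (Suc (Suc l))
        (True = saturated n (target l) (mat l) a n) H M') M' ys'"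
      using scan_correct[of l ?T v a n 0 True H M' ys] Suc by simp
  qed
  moreover have "(n - 1 - a + 1) * (n * (?T + 2) + 1) \<le> n * (n * (?T + 2) + 1)"
    using Suc.prems by (intro mult_le_mono1) simp
  then have "1 + ((n - 0) * (?T + 2) + 1 + (n - 1 - a) * (n * (?T + 2) + 1)) \<le> call_time (Suc l)"
    by simp
  ultimately show ?case
    by (simp only: simp_thms matched.simps) (rule reaches_le)
qed

lemma next_correct:
  "in_next v M \<Longrightarrow> v \<le> n \<Longrightarrow>
    REACHES ((n - v) * (call_time \<Delta> + 2) + 1)
      (\<lambda>M' ys'. M' 3 = 0 \<and> ys' = ys @ filter (mat \<Delta>) [v..<n]) M ys"
proof (induction "n - v" arbitrary: v M ys)
  case 0
  then show ?case using next_end[of M ys] by simp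
next
  case (Suc d)
  then have v: "v < n" by simp
  let ?zs = "if mat \<Delta> v then ys @ [v] else ys"
  have "REACHES 1 (\<lambda>M' ys'. ys' = ys \<and> in_call v \<Delta> v M' M') M ys"
    using Suc.prems v by (intro next_step)
  \<comment> \<open>The existential is needed because \<open>H\<close> is the memory at the call,
    known only after the first iteration.\<close>
  then have "REACHES (1 + call_time \<Delta>)
      (\<lambda>M' ys'. ys' = ys \<and> (\<exists>H. in_return v (Suc \<Delta>) (mat \<Delta> v) H M')) M ys"
  proof (rule reaches_trans, elim conjE)
    fix M' ys'
    assume "ys' = ys" "in_call v \<Delta> v M' M'"
    then have "REACHES (call_time \<Delta>)
        (\<lambda>M'' ys'. ys' = ys \<and> in_return v (Suc \<Delta>) (mat \<Delta> v) M' M'') M' ys'"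
      using call_correct v by simp
    then show "REACHES (call_time \<Delta>)
        (\<lambda>M' ys'. ys' = ys \<and> (\<exists>H. in_return v (Suc \<Delta>) (mat \<Delta> v) H M')) M' ys'"
      by (rule reaches_mono) blast
  qed
  then have "REACHES (1 + call_time \<Delta> + 1) (\<lambda>M' ys'. ys' = ?zs \<and> in_next (Suc v) M') M ys"
    by (rule reaches_trans) (use return_top v in blast)
  then have "REACHES (1 + call_time \<Delta> + 1 + ((n - Suc v) * (call_time \<Delta> + 2) + 1))
      (\<lambda>M' ys'. M' 3 = 0 \<and> ys' = ?zs @ filter (mat \<Delta>) [Suc v..<n]) M ys"
  proof (rule reaches_trans, elim conjE)
    fix M' ys'
    assume "ys' = ?zs" and M': "in_next (Suc v) M'"
    then show "REACHES ((n - Suc v) * (call_time \<Delta> + 2) + 1)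
        (\<lambda>M' ys'. M' 3 = 0 \<and> ys' = ?zs @ filter (mat \<Delta>) [Suc v..<n]) M' ys'"
      using Suc.hyps(1)[of "Suc v" M' ?zs] Suc.hyps(2) v by simp
  qed
  moreover have "?zs @ filter (mat \<Delta>) [Suc v..<n] = ys @ filter (mat \<Delta>) [v..<n]"
    using v by (simp add: upt_conv_Cons)
  moreover have "1 + call_time \<Delta> + 1 + ((n - Suc v) * (call_time \<Delta> + 2) + 1) =
      (n - v) * (call_time \<Delta> + 2) + 1"
    using v by (simp add: Suc_diff_Suc[symmetric])
  ultimately show ?case by simp
qed

lemma degree_correct:
  "in_degree (Max (insert 0 (deg ` {..<v}))) v M \<Longrightarrow> v \<le> n \<Longrightarrow>
    REACHES (n - v + 1) (\<lambda>M' ys'. ys' = ys \<and> in_next 0 M') M ys"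
proof (induction "n - v" arbitrary: v M)
  case 0
  then have "in_degree \<Delta> n M"
    by (simp add: \<Delta>_eq)
  with 0 show ?case using degree_end[of M ys] by simp
next
  case (Suc d)
  then have v: "v < n" by simp
  have "max (Max (insert 0 (deg ` {..<v}))) (deg v) = Max (insert 0 (deg ` {..<Suc v}))"
    by (simp add: lessThan_Suc insert_commute[of 0] max.commute)
  then have "REACHES 1
      (\<lambda>M' ys'. ys' = ys \<and> in_degree (Max (insert 0 (deg ` {..<Suc v}))) (Suc v) M') M ys"
    using degree_step[OF Suc.prems(1) v] by simp
  then have "REACHES (1 + (n - Suc v + 1)) (\<lambda>M' ys'. ys' = ys \<and> in_next 0 M') M ys"
    by (rule reaches_trans) (use Suc v in auto)
  then show ?case
    using v by (simp add: Suc_diff_Suc)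
qed

lemma program_correct:
  "\<exists>t b. t \<le> clen setup_code + (n + 1 + (n * (call_time \<Delta> + 2) + 1)) * (clen main_body + 2) + 1 \<and>
    b \<le> w * S \<and> runs (loop_program setup_code 3 main_body) w x (filter (mat \<Delta>) [0..<n]) t b"
proof (rule loop_program_runs)
  have "REACHES (n + 1 + (n * (call_time \<Delta> + 2) + 1))
      (\<lambda>M ys. M 3 = 0 \<and> ys = filter (mat \<Delta>) [0..<n]) M []" if "in_degree 0 0 M" for M
  proof (rule reaches_trans)
    show "REACHES (n + 1) (\<lambda>M ys. ys = [] \<and> in_next 0 M) M []"
      using degree_correct[of 0 M] that by simp
    show "REACHES (n * (call_time \<Delta> + 2) + 1)
        (\<lambda>M ys. M 3 = 0 \<and> ys = filter (mat \<Delta>) [0..<n]) M' ys'"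
      if "ys' = [] \<and> in_next 0 M'" for M' ys'
      using next_correct[of 0 M' "[]"] that by simp
  qed
  then show "WP setup_code (REACHES (n + 1 + (n * (call_time \<Delta> + 2) + 1))
      (\<lambda>M ys. M 3 = 0 \<and> ys = filter (mat \<Delta>) [0..<n])) (\<lambda>_. 0) []"
    unfolding setup_code_def
    by (simp add: WP_simps S_numeral input_n in_degree_def cong: wp_weak_cong)
qed (simp add: S_def)

end

section \<open>The bounds\<close>

text \<open>The cover \<open>C\<close> ensures that the minimum is attained, by some
  \<open>K\<close>, which is then compared with the matching.\<close>

lemma matched_card_le:
  assumes "\<And>i u. u < f i u \<Longrightarrow> f i u < n \<Longrightarrow> {u, f i u} \<in> E"
    and C: "vertex_cover n E C"
  shows "card {v. v < n \<and> matched n f i v} \<le> 2 * min_vertex_cover n E"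
proof -
  let ?V = "{C. vertex_cover n E C}"
  have "finite ?V"
    by (rule finite_subset[of _ "Pow {..<n}"]) (auto simp: vertex_cover_def)
  then have "min_vertex_cover n E \<in> card ` ?V"
    unfolding min_vertex_cover_def using C by (intro Min_in) auto
  then obtain K where K: "vertex_cover n E K" "card K = min_vertex_cover n E"
    by auto
  then have fin: "finite K"
    by (auto simp: vertex_cover_def intro: finite_subset[of _ "{..<n}"])
  obtain F where F: "F \<subseteq> E" "\<forall>e\<in>F. card e = 2" "disjoint F"
    "\<Union>F = {v. v < n \<and> matched n f i v}"
    using matched_is_matching[of f n E i] assms(1) by blast
  have "finite F"
    by (rule finite_UnionD) (simp add: F(4))
  moreover have "K \<inter> e \<noteq> {}" if "e \<in> F" for e
    using K(1) F(1) that by (auto simp: vertex_cover_def)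
  ultimately show ?thesis
    using matching_le_twice_cover[of F K] F K(2) fin by simp
qed

section \<open>Adjacency arrays and word length\<close>

lemma vertex_degree_eq_length:
  assumes "simple_graph n E" "adjacency_lists n E adj" "v < n"
  shows "vertex_degree E v = length (adj ! v)"
proof -
  have "{e \<in> E. v \<in> e} = (\<lambda>u. {u, v}) ` set (adj ! v)"
    using assms by (fastforce simp: simple_graph_def adjacency_lists_def insert_commute)
  moreover have "inj_on (\<lambda>u. {u, v}) (set (adj ! v))"
    by (auto simp: inj_on_def doubleton_eq_iff)
  moreover have "distinct (adj ! v)"
    using assms by (simp add: adjacency_lists_def)
  ultimately show ?thesis
    by (simp add: vertex_degree_def card_image distinct_card)
qed

lemma neighbour_less:
  assumes "simple_graph n E" "adjacency_lists n E adj" "v < n" "u \<in> set (adj ! v)"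
  shows "u < n"
proof -
  have "{u, v} \<in> E"
    using assms by (simp add: adjacency_lists_def)
  with assms(1) show ?thesis
    by (fastforce simp: simple_graph_def doubleton_eq_iff)
qed

lemma length_neighbours_le:
  assumes "simple_graph n E" "adjacency_lists n E adj" "v < n"
  shows "length (adj ! v) \<le> n"
proof -
  have "card (set (adj ! v)) \<le> card {..<n}"
    using neighbour_less[OF assms] by (intro card_mono) auto
  moreover have "distinct (adj ! v)"
    using assms by (simp add: adjacency_lists_def)
  ultimately show ?thesis
    by (simp add: distinct_card)
qed

lemma length_concat_take_Suc:
  "v < length adj \<Longrightarrow>
    length (concat (take (Suc v) adj)) = length (concat (take v adj)) + length (adj ! v)"
  by (simp add: take_Suc_conv_app_nth)

lemma length_concat_take_le:
  assumes "\<And>v. v < length adj \<Longrightarrow> length (adj ! v) \<le> k"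
  shows "v \<le> length adj \<Longrightarrow> length (concat (take v adj)) \<le> v * k"
proof (induction v)
  case (Suc v)
  then show ?case
    using assms[of v] by (simp only: length_concat_take_Suc Suc_le_eq) simp
qed simp

lemma nth_concat_take:
  assumes "v < length adj" "i < length (adj ! v)"
  shows "length (concat (take v adj)) + i < length (concat adj)"
    and "concat adj ! (length (concat (take v adj)) + i) = adj ! v ! i"
proof -
  have "concat adj = concat (take v adj) @ adj ! v @ concat (drop (Suc v) adj)"
    by (subst id_take_nth_drop[OF assms(1)]) simp
  then show "length (concat (take v adj)) + i < length (concat adj)"
    and "concat adj ! (length (concat (take v adj)) + i) = adj ! v ! i"
    using assms(2) by (simp_all add: nth_append)
qed

text \<open>This turns polynomial bounds on the numbers in use into absence of overflow.\<close>

lemma le_power_word_length: "max 2 n ^ c \<le> 2 ^ word_length c n"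
proof -
  let ?N = "max 2 n" and ?k = "nat \<lceil>log 2 (real (max 2 n))\<rceil>"
  have "real ?N = 2 powr log 2 (real ?N)"
    by simp
  also have "\<dots> \<le> 2 powr real ?k"
    by (intro powr_mono) linarith+
  also have "\<dots> = real (2 ^ ?k)"
    by (subst powr_realpow) auto
  finally have "?N \<le> 2 ^ ?k"
    unfolding of_nat_le_iff .
  then have "?N ^ c \<le> (2 ^ ?k) ^ c"
    by (rule power_mono) simp
  then show ?thesis
    by (simp add: word_length_def power_mult[symmetric] mult.commute)
qed

text \<open>The logarithm is at least 1, so rounding up at most doubles it.\<close>

lemma word_length_le: "real (word_length c n) \<le> 2 * real c * log 2 (real (max 2 n))"
proof -
  have "1 \<le> log 2 (real (max 2 n))"
    by (subst le_log_iff) auto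
  then have "real (nat \<lceil>log 2 (real (max 2 n))\<rceil>) \<le> 2 * log 2 (real (max 2 n))"
    by linarith
  from mult_left_mono[OF this, of "real c"] show ?thesis
    by (simp add: word_length_def mult_ac)
qed

lemma graph_input_adjacency_array:
  assumes g: "simple_graph n E" and adj: "adjacency_lists n E adj"
  shows "graph_input (word_length 8 n) (adjacency_array adj) n
    (\<lambda>v. n + 2 + length (concat (take v adj))) (\<lambda>v. length (adj ! v)) (\<lambda>v i. adj ! v ! i)
    (max_degree n E)"
proof -
  let ?w = "word_length 8 n" and ?x = "adjacency_array adj"
  let ?off = "\<lambda>v. n + 2 + length (concat (take v adj))"
  have len: "length adj = n"
    using adj by (simp add: adjacency_lists_def)
  have deg: "max_degree n E = Max (insert 0 ((\<lambda>v. length (adj ! v)) ` {..<n}))"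
    using vertex_degree_eq_length[OF g adj]
    by (auto simp: max_degree_def intro!: arg_cong[of _ _ "\<lambda>A. Max (insert 0 A)"] image_cong)
  have "max_degree n E \<le> n"
    unfolding deg using length_neighbours_le[OF g adj] by (subst Max_le_iff) auto
  moreover have off: "?off v \<le> n + 2 + n * n" if "v \<le> n" for v
  proof -
    have "length (concat (take v adj)) \<le> v * n"
      using length_concat_take_le[of adj n v] length_neighbours_le[OF g adj] len that by simp
    also have "v * n \<le> n * n"
      using that by simp
    finally show ?thesis by simp
  qed
  \<comment> \<open>The left side collects the bounds for offset, \<open>n\<close>,
    \<open>4 * \<Delta>\<close> and 100. The constant 64 is at most \<open>?N ^ 6\<close>, whence
    the factor 8 in the word length.\<close>
  moreover have "n * n + 6 * n + 102 < 2 ^ ?w"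
  proof -
    let ?N = "max 2 n"
    have "2 * ?N \<le> ?N * ?N" "n * n \<le> ?N * ?N" "n \<le> ?N" "2 \<le> ?N"
      by (auto intro: mult_mono)
    then have "n * n + 6 * n + 102 < 64 * (?N * ?N)"
      by linarith
    also have "\<dots> \<le> ?N ^ 6 * (?N * ?N)"
      using power_mono[of 2 ?N 6] by (intro mult_le_mono1) simp
    also have "\<dots> = ?N ^ 8"
      by (simp add: eval_nat_numeral)
    also have "\<dots> \<le> 2 ^ ?w"
      by (rule le_power_word_length)
    finally show ?thesis .
  qed
  ultimately have bound: "?off v + n + 4 * max_degree n E + 100 < 2 ^ ?w" if "v \<le> n" for v
    using that by fastforce
  have small: "n < 2 ^ ?w" "\<And>v. v \<le> n \<Longrightarrow> ?off v < 2 ^ ?w"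
    using bound[of 0] bound by (simp, fastforce)
  have x: "?x = n # map ?off [0..<n + 1] @ concat adj"
    by (simp add: adjacency_array_def len Let_def)
  have xl: "length ?x = n + 2 + length (concat adj)"
    unfolding x by simp
  show ?thesis
  proof
    show "input_word ?w ?x 0 = n"
      using small by (simp add: input_word_def x)
    show "input_word ?w ?x (Suc v) = ?off v" if "v \<le> n" for v
    proof -
      have "?x ! Suc v = ?off v"
        unfolding x using that by (simp add: nth_append del: upt_Suc)
      then show ?thesis
        using small(2)[OF that] that xl by (simp add: input_word_def)
    qed
    show "?off (Suc v) = ?off v + length (adj ! v)" if "v < n" for v
      using that len by (simp add: take_Suc_conv_app_nth)
    show less: "adj ! v ! i < n" if "v < n" "i < length (adj ! v)" for v i
      using neighbour_less[OF g adj that(1)] that(2) by simp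
    show "input_word ?w ?x (?off v + i) = adj ! v ! i" if "v < n" "i < length (adj ! v)" for v i
    proof -
      have "?x ! (?off v + i) = concat adj ! (length (concat (take v adj)) + i)"
        unfolding x by (simp add: nth_append del: upt_Suc)
      then have "?x ! (?off v + i) = adj ! v ! i"
        using nth_concat_take(2)[of v adj i] that len by simp
      moreover have "length (concat (take v adj)) + i < length (concat adj)"
        using nth_concat_take(1)[of v adj i] that len by simp
      ultimately show ?thesis
        using less[OF that] small(1) xl by (simp add: input_word_def)
    qed
  qed (use bound deg in auto)
qed

section \<open>Time bounds\<close>

context graph_input
begin

text \<open>Of the three factors per level, two come from the recurrence and one absorbs the
  doubling caused by the lower-order terms.\<close>

lemma call_time_le: "call_time l + 2 \<le> max 2 n ^ (3 * l + 2)"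
proof (induction l)
  case 0
  have "call_time 0 + 2 \<le> 2 ^ 2" by simp
  also have "\<dots> \<le> max 2 n ^ (3 * 0 + 2)"
    unfolding mult_0_right add_0 by (intro power_mono) auto
  finally show ?case .
next
  case (Suc l)
  let ?N = "max 2 n" and ?a = "max 2 n ^ (3 * l + 2)"
  have "(2::nat) ^ 2 \<le> ?N ^ 2"
    by (intro power_mono) auto
  also have "\<dots> \<le> ?a"
    by (intro power_increasing) auto
  finally have a: "4 \<le> ?a" by simp
  have sq: "2 * ?N \<le> ?N * ?N" "2 \<le> ?N" "n \<le> ?N"
    by (auto intro: mult_mono)
  have "n * (n * (call_time l + 2)) \<le> ?N * (?N * ?a)"
    using Suc.IH by (intro mult_mono) auto
  moreover have "n + 3 \<le> 4 * (?N * ?N)"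
    using sq by linarith
  moreover have "4 * (?N * ?N) \<le> ?N * (?N * ?a)"
    using mult_le_mono1[OF a, of "?N * ?N"] by (simp only: mult_ac)
  moreover have "call_time (Suc l) + 2 = n + 3 + n * (n * (call_time l + 2))"
    by (simp add: algebra_simps)
  ultimately have "call_time (Suc l) + 2 \<le> 2 * (?N * (?N * ?a))"
    by linarith
  also have "\<dots> \<le> ?N * (?N * (?N * ?a))"
    by (rule mult_le_mono1) simp
  also have "\<dots> = ?N ^ (3 * Suc l + 2)"
    by (simp add: eval_nat_numeral)
  finally show ?case .
qed

text \<open>Since the base is at least 2, constants become powers of it: 8 for the length of the
  body, 1 for adding the degree loop, 1 for the setup.\<close>

lemma program_time_le:
  "clen setup_code + (n + 1 + (n * (call_time \<Delta> + 2) + 1)) * (clen main_body + 2) + 1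
    \<le> max 2 n ^ (3 * \<Delta> + 13)"
proof -
  let ?N = "max 2 n" and ?a = "max 2 n ^ (3 * \<Delta> + 3)"
  have N: "2 \<le> ?N" "n \<le> ?N" by auto
  have "(2::nat) ^ 8 \<le> ?N ^ 8"
    by (intro power_mono) auto
  moreover have "clen main_body + 2 \<le> 256"
    by (simp add: main_body_def on_mode_def degree_mode_def next_mode_def call_mode_def
        scan_mode_def return_mode_def load_frame_def store_frame_def frame_address_def
        find_target_def copy_def)
  ultimately have L: "clen main_body + 2 \<le> ?N ^ 8"
    by simp
  have "n * (call_time \<Delta> + 2) \<le> ?N * ?N ^ (3 * \<Delta> + 2)"
    using call_time_le[of \<Delta>] by (intro mult_mono) auto
  then have "n * (call_time \<Delta> + 2) \<le> ?a"
    by (simp add: eval_nat_numeral)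
  moreover have "n + 2 \<le> ?a"
  proof -
    have "n + 2 \<le> 2 * ?N" by simp
    also have "\<dots> \<le> ?N * ?N" using N by (intro mult_mono) auto
    also have "\<dots> = ?N ^ 2" by (simp add: power2_eq_square)
    also have "\<dots> \<le> ?a" by (intro power_increasing) auto
    finally show ?thesis .
  qed
  ultimately have "n + 1 + (n * (call_time \<Delta> + 2) + 1) \<le> 2 * ?a"
    by simp
  also have "\<dots> \<le> ?N * ?a"
    using N by (intro mult_mono) auto
  finally have "(n + 1 + (n * (call_time \<Delta> + 2) + 1)) * (clen main_body + 2)
      \<le> (?N * ?a) * ?N ^ 8"
    using L by (rule mult_le_mono)
  moreover have "(?N * ?a) * ?N ^ 8 = ?N ^ (3 * \<Delta> + 12)"
    by (simp add: power_add[symmetric] flip: power_Suc)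
  moreover have "clen setup_code + 1 \<le> ?N ^ (3 * \<Delta> + 12)"
  proof -
    have "clen setup_code + 1 = 2 ^ 2" by (simp add: setup_code_def)
    also have "\<dots> \<le> ?N ^ 2" by (intro power_mono) auto
    also have "\<dots> \<le> ?N ^ (3 * \<Delta> + 12)" by (intro power_increasing) auto
    finally show ?thesis .
  qed
  ultimately have "clen setup_code + (n + 1 + (n * (call_time \<Delta> + 2) + 1)) * (clen main_body + 2) + 1
      \<le> 2 * ?N ^ (3 * \<Delta> + 12)"
    by simp
  also have "\<dots> \<le> ?N * ?N ^ (3 * \<Delta> + 12)"
    using N by (intro mult_mono) auto
  also have "\<dots> = ?N ^ (3 * \<Delta> + 13)"
    by (simp add: eval_nat_numeral)
  finally show ?thesis .
qed

end

theorem theorem3: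
  shows "\<exists>(P :: program) (c :: nat) (K :: nat). 0 < c \<and>
    (\<forall>(n :: nat) (E :: nat set set) (x :: nat list).
      simple_graph n E \<and> represents x n E \<longrightarrow>
      (\<exists>ys t b. runs P (word_length c n) x ys t b \<and>
         distinct ys \<and> vertex_cover n E (set ys) \<and>
         card (set ys) \<le> 2 * min_vertex_cover n E \<and>
         t \<le> max 2 n ^ (K * max 1 (max_degree n E)) \<and>
         real b \<le> real K * real (max 1 (max_degree n E)) * log 2 (real (max 2 n))))"
proof (rule exI[of _ "loop_program setup_code 3 main_body"], rule exI[of _ "8::nat"],
    rule exI[of _ "448::nat"], intro conjI allI impI)
  fix n E x
  assume "simple_graph n E \<and> represents x n E"
  then obtain adj where g: "simple_graph n E" and adj: "adjacency_lists n E adj"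
    and x: "x = adjacency_array adj"
    by (auto simp: represents_def)
  let ?\<Delta> = "max_degree n E" and ?w = "word_length 8 n"
  interpret graph_input ?w x n "\<lambda>v. n + 2 + length (concat (take v adj))"
    "\<lambda>v. length (adj ! v)" "\<lambda>v i. adj ! v ! i" ?\<Delta>
    unfolding x by (rule graph_input_adjacency_array[OF g adj])
  let ?ys = "filter (mat ?\<Delta>) [0..<n]"
  have set: "set ?ys = {v. v < n \<and> mat ?\<Delta> v}"
    by auto
  obtain t b where run: "runs (loop_program setup_code 3 main_body) ?w x ?ys t b"
    and t: "t \<le> max 2 n ^ (3 * ?\<Delta> + 13)" and b: "b \<le> ?w * S"
    using program_correct program_time_le by (meson order.trans)
  have edge: "{u, target i u} \<in> E" if "u < target i u" "target i u < n" for i u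
  proof -
    from that have "i < length (adj ! u)" "target i u = adj ! u ! i"
      by (auto simp: target_def split: if_splits)
    then have "target i u \<in> set (adj ! u)"
      by simp
    moreover have "u < n"
      using that by simp
    ultimately show ?thesis
      using adj by (simp add: adjacency_lists_def insert_commute)
  qed
  \<comment> \<open>The position \<open>i\<close> of \<open>v\<close> in the list of
    \<open>u\<close> is the stage that handles the edge; it is below the maximum degree, and matched
    vertices stay matched.\<close>
  have cover: "mat ?\<Delta> u \<or> mat ?\<Delta> v" if "{u, v} \<in> E" "u < v" "v < n" for u v
  proof -
    have "v \<in> set (adj ! u)"
      using adj that by (simp add: adjacency_lists_def insert_commute)
    then obtain i where i: "i < length (adj ! u)" "adj ! u ! i = v"
      by (auto simp: in_set_conv_nth)
    then have "target i u = v"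
      by (simp add: target_def)
    then have "mat (Suc i) u \<or> mat (Suc i) v"
      using matched_endpoint[of u target i n] that by simp
    moreover have "Suc i \<le> ?\<Delta>"
    proof -
      have "length (adj ! u) \<le> ?\<Delta>"
        unfolding \<Delta>_eq using that by (intro Max_ge) auto
      with i(1) show ?thesis by simp
    qed
    ultimately show ?thesis
      using matched_mono by blast
  qed
  have "vertex_cover n E (set ?ys)"
    unfolding vertex_cover_def set
  proof (intro conjI ballI)
    fix e assume e: "e \<in> E"
    with g obtain u v where "u < n" "v < n" "u \<noteq> v" "e = {u, v}"
      unfolding simple_graph_def by blast
    then obtain u v where "u < v" "v < n" "e = {u, v}"
      by (metis insert_commute linorder_neqE_nat)
    then show "{v. v < n \<and> mat ?\<Delta> v} \<inter> e \<noteq> {}"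
      using cover[of u v] e by auto
  qed auto
  moreover from this have "card (set ?ys) \<le> 2 * min_vertex_cover n E"
    unfolding set using edge by (intro matched_card_le)
  moreover have "t \<le> max 2 n ^ (448 * max 1 ?\<Delta>)"
    using t by (rule order.trans) (intro power_increasing, auto)
  moreover have "real b \<le> real 448 * real (max 1 ?\<Delta>) * log 2 (real (max 2 n))"
  proof -
    have "real b \<le> real ?w * real S"
      using b by (metis of_nat_le_iff of_nat_mult)
    \<comment> \<open>The constant 448 is \<open>2 * 8 * 28\<close>, where 28 comes from
      \<open>24 + 4 * ?\<Delta> \<le> 28 * max 1 ?\<Delta>\<close>.\<close>
    also have "\<dots> \<le> (2 * real 8 * log 2 (real (max 2 n))) * (28 * real (max 1 ?\<Delta>))"
      using word_length_le[of 8 n] by (intro mult_mono) (auto simp: S_def)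
    finally show ?thesis
      by (simp add: mult_ac)
  qed
  ultimately show "\<exists>ys t b. runs (loop_program setup_code 3 main_body) ?w x ys t b \<and>
      distinct ys \<and> vertex_cover n E (set ys) \<and> card (set ys) \<le> 2 * min_vertex_cover n E \<and>
      t \<le> max 2 n ^ (448 * max 1 ?\<Delta>) \<and>
      real b \<le> real 448 * real (max 1 ?\<Delta>) * log 2 (real (max 2 n))"
    using run by (intro exI[of _ ?ys] exI[of _ t] exI[of _ b]) simp
qed simp

end
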